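(* Each $(\boldsymbol\omega,\mathbf{A})\in\mathcal{P}_{1,4}$ has exactly $N-1$ eigenvalues, and each $(\boldsymbol\omega,\mathbf{A})\in(\Omega_N^{\mathbb{R},+}\times\mathcal{O}_{1,4}^{\mathbb{C}})\setminus\mathcal{P}_{1,4}$ has exactly $N$ eigenvalues $\lambda_n(\boldsymbol\omega,\mathbf{A})$, $0\le n\le N-1$, which satisfy that: (i) the $\lambda_n(\boldsymbol\omega,\mathbf{A})$ are continuous in $(\Omega_N^{\mathbb{R},+}\times\mathcal{O}_{1,4}^{\mathbb{C}})\setminus\mathcal{P}_{1,4}$; (ii) the $\lambda_n(\boldsymbol\omega,\mathbf{A})$, $0\le n\le N-1$, are not continuous at each point of $\mathcal{P}_{1,4}$ and have the following asymptotic behaviors near any given $(\boldsymbol\omega_0,\mathbf{A}_0)\in\mathcal{P}_{1,4}$: $$\lim_{\mathcal{P}_{1,4}^-\cup\mathcal{P}_{1,4}\ni(\boldsymbol\omega,\mathbf{A})\to(\boldsymbol\omega_0,\mathbf{A}_0)}\lambda_n(\boldsymbol\omega,\mathbf{A})=\lambda_n(\boldsymbol\omega_0,\mathbf{A}_0),\ 0\le n\le N-2,$$ $$\lim_{\mathcal{P}_{1,4}^-\ni(\boldsymbol\omega,\mathbf{A})\to(\boldsymbol\omega_0,\mathbf{A}_0)}\lambda_{N-1}(\boldsymbol\omega,\mathbf{A})=+\infty,\qquad \lim_{\mathcal{P}_{1,4}^+\ni(\boldsymbol\omega,\mathbf{A})\to(\boldsymbol\omega_0,\mathbf{A}_0)}\lambda_0(\boldsymbol\omega,\mathbf{A})=-\infty,$$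 $$\lim_{\mathcal{P}_{1,4}^+\ni(\boldsymbol\omega,\mathbf{A})\to(\boldsymbol\omega_0,\mathbf{A}_0)}\lambda_n(\boldsymbol\omega,\mathbf{A})=\lambda_{n-1}(\boldsymbol\omega_0,\mathbf{A}_0),\ 1\le n\le N-1,$$ and consequently, $\lambda_n$ restricted in $\mathcal{P}_{1,4}^-\cup\mathcal{P}_{1,4}$ is continuous for each $0\le n\le N-2$.
   Context: Fix an integer $N\ge 2$. A self-adjoint discrete Sturm–Liouville problem is a pair $(\boldsymbol\omega,\mathbf{A})$. Here $\boldsymbol\omega=(1/f,q,w)$ with real sequences $f=\{f_n\}_{n=0}^N$, $q=\{q_n\}_{n=1}^N$, $w=\{w_n\}_{n=1}^N$, $f_n\ne0$, $w_n>0$, encodes the equation $-\nabla(f_n\Delta y_n)+q_ny_n=\lambda w_ny_n$, $1\le n\le N$, for $y=(y_0,\dots,y_{N+1})$, with $\Delta y_n=y_{n+1}-y_n$, $\nabla y_n=y_n-y_{n-1}$; the set $\Omega_N^{\mathbb{R},+}$ of all such $(1/f,q,w)$ has the topology of a subset of $\mathbb{R}^{3N+1}$. $\mathbf{A}=[A\,|\,B]$ encodes the boundary condition $A\begin{pmatrix}y_0\\ f_0\Delta y_0\end{pmatrix}+B\begin{pmatrix}y_N\\ f_N\Delta y_N\end{pmatrix}=0$, where $A,B$ are complex $2\times2$ matrices with $\mathrm{rank}(A,B)=2$ and $AJA^*=BJB^*$, $J=\begin{pmatrix}0&1\\-1&0\end{pmatrix}$; $[A\,|\,B]$ is the class of the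 $2\times4$ matrix $(A,B)$ modulo left multiplication by $GL(2,\mathbb{C})$, and $\mathcal{B}^{\mathbb{C}}$ is the set of all such classes, topologized as a subspace of the quotient of the rank-2 complex $2\times4$ matrices by $GL(2,\mathbb{C})$. $\Omega_N^{\mathbb{R},+}\times\mathcal{B}^{\mathbb{C}}$ has the product topology. An eigenvalue of $(\boldsymbol\omega,\mathbf{A})$ is a $\lambda$ for which a nonzero $y$ solves the equation and the boundary condition. Eigenvalues are real and finite in number; they are counted with multiplicity (the dimension of the solution space) and listed as $\lambda_0\le\lambda_1\le\cdots$; $\lambda_n$ is defined at a problem only if it has more than $n$ eigenvalues, and $\lambda_n$ is regarded as not continuous at a point where it is not defined. $\mathcal{O}_{1,4}^{\mathbb{C}}=\left\{\left[\begin{array}{cccc}1&a_{12}&\bar z&0\\0&z&b_{21}&1\end{array}\right]:a_{12},b_{21}\in\mathbb{R},\ z\in\mathbb{C}\right\}$, an open subset of $\mathcal{B}^{\mathbb{C}}$. $\mathcal{P}_{1,4}$, $\mathcal{P}_{1,4}^+$, $\mathcal{P}_{1,4}^-$ are the sets of $(\boldsymbol\omega,\mathbf{A})\in\Omega_N^{\mathbb{R},+}\times\mathcal{O}_{1,4}^{\mathbb{C}}$ with $a_{12}=1/f_0$, $a_{12}>1/f_0$, $a_{12}<1/f_0$, respectively.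
   Formalization: Discontinuity of λ_n at a point of P_{1,4} is claimed except when 1≤n≤N−2 and λ_{n−1}=λ_n at that point; there the stated limits from both sides agree, so λ_n is in fact continuous (e.g. N=3, f=1, q=0, w=1, a12=1, z=1, b21=2, n=1). *)

theory Defs
  imports "HOL-Analysis.Analysis" "HOL-Library.Function_Algebras" "HOL-Library.Multiset"
begin

text \<open>
  An equation is a triple \<open>(1/f, q, w)\<close> of real sequences indexed by \<open>{0..N}\<close>, \<open>{1..N}\<close> and
  \<open>{1..N}\<close>; outside its index set each sequence is \<open>undefined\<close> (the convention of
  \<^const>\<open>product_topology\<close>).  The first component stores \<open>1/f\<close>, not \<open>f\<close>.
\<close>

type_synonym equation = "(nat \<Rightarrow> real) \<times> (nat \<Rightarrow> real) \<times> (nat \<Rightarrow> real)"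

definition Omega :: "nat \<Rightarrow> equation set" where
  "Omega N = {(restrict (\<lambda>n. 1 / f n) {0..N}, restrict q {1..N}, restrict w {1..N}) | f q w.
                (\<forall>n\<in>{0..N}. f n \<noteq> 0) \<and> (\<forall>n\<in>{1..N}. w n > 0)}"

definition Omega_top :: "nat \<Rightarrow> equation topology" where
  "Omega_top N =
     subtopology
       (prod_topology (product_topology (\<lambda>_. euclideanreal) {0..N})
         (prod_topology (product_topology (\<lambda>_. euclideanreal) {1..N})
           (product_topology (\<lambda>_. euclideanreal) {1..N})))
       (Omega N)"

definition f_of :: "equation \<Rightarrow> nat \<Rightarrow> real" where
  "f_of \<omega> n = 1 / fst \<omega> n"

definition q_of :: "equation \<Rightarrow> nat \<Rightarrow> real" where
  "q_of \<omega> = fst (snd \<omega>)"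

definition w_of :: "equation \<Rightarrow> nat \<Rightarrow> real" where
  "w_of \<omega> = snd (snd \<omega>)"

definition fdiff :: "(nat \<Rightarrow> complex) \<Rightarrow> nat \<Rightarrow> complex" where
  "fdiff y n = y (n + 1) - y n"

definition bdiff :: "(nat \<Rightarrow> complex) \<Rightarrow> nat \<Rightarrow> complex" where
  "bdiff y n = y n - y (n - 1)"

definition solves_eq :: "nat \<Rightarrow> equation \<Rightarrow> complex \<Rightarrow> (nat \<Rightarrow> complex) \<Rightarrow> bool" where
  "solves_eq N \<omega> \<mu> y \<longleftrightarrow>
     (\<forall>n\<in>{1..N}. - bdiff (\<lambda>k. of_real (f_of \<omega> k) * fdiff y k) n + of_real (q_of \<omega> n) * y n
                  = \<mu> * of_real (w_of \<omega> n) * y n)"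

lemma vector_4 [simp]:
  "(vector [a, b, c, d] :: 'a::zero^4) $ 1 = a"
  "(vector [a, b, c, d] :: 'a::zero^4) $ 2 = b"
  "(vector [a, b, c, d] :: 'a::zero^4) $ 3 = c"
  "(vector [a, b, c, d] :: 'a::zero^4) $ 4 = d"
  by (simp_all add: vector_def)

definition left_block :: "complex^4^2 \<Rightarrow> complex^2^2" where
  "left_block M = (\<chi> i. vector [M $ i $ 1, M $ i $ 2])"

definition right_block :: "complex^4^2 \<Rightarrow> complex^2^2" where
  "right_block M = (\<chi> i. vector [M $ i $ 3, M $ i $ 4])"

definition J_mat :: "complex^2^2" where
  "J_mat = vector [vector [0, 1], vector [-1, 0]]"

definition adjoint_matrix :: "complex^2^2 \<Rightarrow> complex^2^2" where
  "adjoint_matrix A = map_matrix cnj (transpose A)"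

definition self_adjoint_bc :: "complex^4^2 \<Rightarrow> bool" where
  "self_adjoint_bc M \<longleftrightarrow>
     left_block M ** J_mat ** adjoint_matrix (left_block M)
     = right_block M ** J_mat ** adjoint_matrix (right_block M)"

definition GL_class :: "complex^4^2 \<Rightarrow> (complex^4^2) set" where
  "GL_class M = {G ** M | G :: complex^2^2. invertible G}"

definition rank2_matrices :: "(complex^4^2) set" where
  "rank2_matrices = {M. rank M = 2}"

definition BC :: "(complex^4^2) set set" where
  "BC = GL_class ` {M \<in> rank2_matrices. self_adjoint_bc M}"

lemma istopology_image_quotient:
  fixes g :: "'a::topological_space \<Rightarrow> 'b"
  shows "istopology (\<lambda>U. U \<subseteq> g ` R \<and> openin (top_of_set R) (R \<inter> g -` U))"
  unfolding istopology_def
proof (intro conjI allI impI)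
  fix S T
  assume S: "S \<subseteq> g ` R \<and> openin (top_of_set R) (R \<inter> g -` S)"
    and T: "T \<subseteq> g ` R \<and> openin (top_of_set R) (R \<inter> g -` T)"
  show "S \<inter> T \<subseteq> g ` R" using S by blast
  have "R \<inter> g -` (S \<inter> T) = (R \<inter> g -` S) \<inter> (R \<inter> g -` T)" by blast
  then show "openin (top_of_set R) (R \<inter> g -` (S \<inter> T))"
    using S T by (simp only: openin_Int)
next
  fix K
  assume K: "\<forall>U\<in>K. U \<subseteq> g ` R \<and> openin (top_of_set R) (R \<inter> g -` U)"
  show "\<Union>K \<subseteq> g ` R" using K by blast
  have "R \<inter> g -` (\<Union>K) = (\<Union>U\<in>K. R \<inter> g -` U)" by blast
  moreover have "openin (top_of_set R) (\<Union>U\<in>K. R \<inter> g -` U)"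
    using K by (intro openin_Union) blast
  ultimately show "openin (top_of_set R) (R \<inter> g -` (\<Union>K))" by (simp only:)
qed

definition quotient_top :: "(complex^4^2) set topology" where
  "quotient_top = topology (\<lambda>U. U \<subseteq> GL_class ` rank2_matrices \<and>
     openin (top_of_set rank2_matrices) (rank2_matrices \<inter> GL_class -` U))"

lemma openin_quotient_top:
  "openin quotient_top U \<longleftrightarrow> U \<subseteq> GL_class ` rank2_matrices \<and>
     openin (top_of_set rank2_matrices) (rank2_matrices \<inter> GL_class -` U)"
  unfolding quotient_top_def
  by (subst topology_inverse' [OF istopology_image_quotient]) (rule refl)

lemma topspace_quotient_top: "topspace quotient_top = GL_class ` rank2_matrices"
proof (rule subset_antisym)
  show "topspace quotient_top \<subseteq> GL_class ` rank2_matrices"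
    using openin_topspace [of quotient_top] unfolding openin_quotient_top by (rule conjunct1)
  have "rank2_matrices \<inter> GL_class -` (GL_class ` rank2_matrices) = rank2_matrices" by blast
  then have "openin quotient_top (GL_class ` rank2_matrices)"
    by (simp only: openin_quotient_top openin_subtopology_self subset_refl simp_thms)
  then show "GL_class ` rank2_matrices \<subseteq> topspace quotient_top"
    by (rule openin_subset)
qed

definition BC_top :: "(complex^4^2) set topology" where
  "BC_top = subtopology quotient_top BC"

type_synonym problem = "equation \<times> (complex^4^2) set"

definition problem_top :: "nat \<Rightarrow> problem topology" where
  "problem_top N = prod_topology (Omega_top N) BC_top"

definition satisfies_bc :: "nat \<Rightarrow> equation \<Rightarrow> complex^4^2 \<Rightarrow> (nat \<Rightarrow> complex) \<Rightarrow> bool" where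
  "satisfies_bc N \<omega> M y \<longleftrightarrow>
     left_block M *v vector [y 0, of_real (f_of \<omega> 0) * fdiff y 0]
     + right_block M *v vector [y N, of_real (f_of \<omega> N) * fdiff y N] = 0"

text \<open>
  A vector \<open>(y\<^sub>0, \<dots>, y\<^bsub>N+1\<^esub>)\<close> is a complex sequence vanishing beyond \<open>N + 1\<close>, so that these
  vectors form a linear subspace.  All representatives of a class impose the same condition.
\<close>

definition solutions :: "nat \<Rightarrow> problem \<Rightarrow> complex \<Rightarrow> (nat \<Rightarrow> complex) set" where
  "solutions N p \<mu> = {y. (\<forall>n>N + 1. y n = 0) \<and> solves_eq N (fst p) \<mu> y \<and>
                         (\<forall>M\<in>snd p. satisfies_bc N (fst p) M y)}"

definition eigenvalues :: "nat \<Rightarrow> problem \<Rightarrow> complex set" where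
  "eigenvalues N p = {\<mu>. \<exists>y\<in>solutions N p \<mu>. y \<noteq> 0}"

global_interpretation cseq: vector_space "\<lambda>(c::complex) (y::nat \<Rightarrow> complex) n. c * y n"
  by standard (auto simp: fun_eq_iff algebra_simps)

definition multiplicity_of :: "nat \<Rightarrow> problem \<Rightarrow> complex \<Rightarrow> nat" where
  "multiplicity_of N p \<mu> = cseq.dim (solutions N p \<mu>)"

definition spectrum :: "nat \<Rightarrow> problem \<Rightarrow> complex multiset" where
  "spectrum N p = (\<Sum>\<mu>\<in>eigenvalues N p. replicate_mset (multiplicity_of N p \<mu>) \<mu>)"

text \<open>
  The finiteness and reality of the eigenvalues are part of this predicate, because a sum over
  an infinite set is zero and because \<open>eigval\<close> lists real parts.
\<close>

definition has_exactly_eigenvalues :: "nat \<Rightarrow> problem \<Rightarrow> nat \<Rightarrow> bool" where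
  "has_exactly_eigenvalues N p k \<longleftrightarrow>
     finite (eigenvalues N p) \<and> eigenvalues N p \<subseteq> \<real> \<and> size (spectrum N p) = k"

definition eigval_defined :: "nat \<Rightarrow> nat \<Rightarrow> problem set" where
  "eigval_defined N n = {p \<in> topspace (problem_top N). n < size (spectrum N p)}"

text \<open>Meaningful only on \<open>eigval_defined N n\<close>; elsewhere the value of \<open>!\<close> is unspecified.\<close>

definition eigval :: "nat \<Rightarrow> nat \<Rightarrow> problem \<Rightarrow> real" where
  "eigval N n p = sorted_list_of_multiset (image_mset Re (spectrum N p)) ! n"

text \<open>
  Continuity of a partially defined function: \<open>p\<close> must lie in the domain, and the limit is taken
  along the domain, in the topology of all problems (not only those in a chart).
\<close>

definition eigval_continuous_at :: "nat \<Rightarrow> nat \<Rightarrow> problem \<Rightarrow> bool" where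
  "eigval_continuous_at N n p \<longleftrightarrow> p \<in> eigval_defined N n \<and>
     (eigval N n \<longlongrightarrow> eigval N n p) (atin_within (problem_top N) p (eigval_defined N n))"

definition normal_14 :: "real \<Rightarrow> complex \<Rightarrow> real \<Rightarrow> complex^4^2" where
  "normal_14 a z b = vector [vector [1, of_real a, cnj z, 0],
                             vector [0, z, of_real b, 1]]"

definition O14 :: "(complex^4^2) set set" where
  "O14 = {GL_class (normal_14 a z b) | a z b. True}"

text \<open>The entries \<open>a, z, b\<close> are determined by the class, so these three sets are disjoint.\<close>

definition P14 :: "nat \<Rightarrow> problem set" where
  "P14 N = {(\<omega>, GL_class (normal_14 a z b)) | \<omega> a z b. \<omega> \<in> Omega N \<and> a = 1 / f_of \<omega> 0}"

definition P14_plus :: "nat \<Rightarrow> problem set" where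
  "P14_plus N = {(\<omega>, GL_class (normal_14 a z b)) | \<omega> a z b. \<omega> \<in> Omega N \<and> a > 1 / f_of \<omega> 0}"

definition P14_minus :: "nat \<Rightarrow> problem set" where
  "P14_minus N = {(\<omega>, GL_class (normal_14 a z b)) | \<omega> a z b. \<omega> \<in> Omega N \<and> a < 1 / f_of \<omega> 0}"

end

theory Submission
  imports Defs
begin

text \<open>
  Eliminate \<open>y\<^sub>0\<close> and \<open>y\<^bsub>N+1\<^esub>\<close>, put \<open>\<epsilon> = 1/f\<^sub>0 - a\<close> and use
  \<open>x\<^sub>1 = y\<^sub>1 + cnj z y\<^sub>N\<close>, \<open>x\<^sub>n = y\<^sub>n\<close> otherwise, as coordinates.  The problem becomes the
  eigenvalue problem of a Hermitian pencil \<open>B + (1/\<epsilon>) |x\<^sub>1|\<^sup>2\<close> against a positive definite form, where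
  \<open>B\<close> depends continuously on the problem; for \<open>\<epsilon> = 0\<close> it is the pencil of \<open>B\<close> on the hyperplane
  \<open>x\<^sub>1 = 0\<close>.  By the Courant--Fischer principle, \<open>\<lambda>\<^sub>n < t\<close> and \<open>\<lambda>\<^sub>n > t\<close> are witnessed by a subspace on
  which a form is definite, and definiteness on a subspace is stable under small perturbations.  As
  \<open>\<epsilon> \<rightarrow> 0\<close> from above (below) the penalty drives exactly one eigenvalue to \<open>+\<infinity>\<close> (\<open>-\<infinity>\<close>) and the others
  to the eigenvalues on the hyperplane.
\<close>

section \<open>Hermitian forms on finitely supported sequences\<close>

text \<open>With the flux u = f_0 (y_1 - y_0) the first boundary row is y_0 + a u + cnj z y_N = 0,
  while y_1 = y_0 + u / f_0. Together they give x_1 = \<epsilon> u, which is the origin of both x_1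
  and \<epsilon>. If r_1 denotes what the equation at n = 1 leaves without u, that equation becomes
  r_1 + x_1 / \<epsilon> = 0, the row of a penalty. For \<epsilon> = 0 the row disappears, x_1 = 0
  becomes a constraint, and r_1 = -u is its free multiplier. The obstacle is that the penalised form
  has no limit as \<epsilon> tends to 0. Eigenvalues are therefore bounded through test spaces
  spanned by eigenvectors of the limit problem, on which the penalty vanishes, enlarged by the
  direction of x_1 when the penalty is large and negative. Negating the forms turns such upper
  bounds into lower bounds.\<close>

definition hermitian_form :: "((nat \<Rightarrow> complex) \<Rightarrow> (nat \<Rightarrow> complex) \<Rightarrow> complex) \<Rightarrow> bool" where
  "hermitian_form B \<longleftrightarrow>
     (\<forall>c x x' y. B (\<lambda>n. c * x n + x' n) y = c * B x y + B x' y) \<and> (\<forall>x y. B y x = cnj (B x y))"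

text \<open>Forms act on all sequences and finite dimension enters only here, so that one form can
  be studied both on \<open>{1..N}\<close> and on the hyperplane \<open>{2..N}\<close>.\<close>

definition supported :: "nat set \<Rightarrow> (nat \<Rightarrow> complex) set" where
  "supported J = {x. \<forall>n. n \<notin> J \<longrightarrow> x n = 0}"

definition unit_vec :: "nat \<Rightarrow> nat \<Rightarrow> complex" where
  "unit_vec k n = (if n = k then 1 else 0)"

definition lin_comb :: "'i set \<Rightarrow> ('i \<Rightarrow> complex) \<Rightarrow> ('i \<Rightarrow> nat \<Rightarrow> complex) \<Rightarrow> nat \<Rightarrow> complex" where
  "lin_comb I c u n = (\<Sum>i\<in>I. c i * u i n)"

section \<open>Algebra of Hermitian forms and linear combinations\<close>

lemma hermitian_form_comb:
  "hermitian_form B \<Longrightarrow> B (\<lambda>n. c * x n + x' n) y = c * B x y + B x' y"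
  unfolding hermitian_form_def by blast

lemma hermitian_form_cnj: "hermitian_form B \<Longrightarrow> B y x = cnj (B x y)"
  unfolding hermitian_form_def by blast

lemma hermitian_formI:
  assumes "\<And>c x x' y. B (\<lambda>n. c * x n + x' n) y = c * B x y + B x' y" "\<And>x y. B y x = cnj (B x y)"
  shows "hermitian_form B"
  using assms unfolding hermitian_form_def by blast

lemma hermitian_form_comb_right:
  assumes "hermitian_form B"
  shows "B y (\<lambda>n. c * x n + x' n) = cnj c * B y x + B y x'"
proof -
  have "B y (\<lambda>n. c * x n + x' n) = cnj (c * B x y + B x' y)"
    by (simp only: hermitian_form_cnj[OF assms, of y "\<lambda>n. c * x n + x' n"] hermitian_form_comb[OF assms])
  also have "\<dots> = cnj c * B y x + B y x'"
    by (simp only: complex_cnj_add complex_cnj_mult hermitian_form_cnj[OF assms, of y x]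
        hermitian_form_cnj[OF assms, of y x'])
  finally show ?thesis .
qed

lemma hermitian_form_add_scaleR:
  assumes B: "hermitian_form B" and C: "hermitian_form C"
  shows "hermitian_form (\<lambda>x y. B x y + of_real s * C x y)"
proof (rule hermitian_formI)
  show "B (\<lambda>n. c * x n + x' n) y + of_real s * C (\<lambda>n. c * x n + x' n) y =
      c * (B x y + of_real s * C x y) + (B x' y + of_real s * C x' y)" for c x x' y
    unfolding hermitian_form_comb[OF B] hermitian_form_comb[OF C] by (simp add: algebra_simps)
  show "B y x + of_real s * C y x = cnj (B x y + of_real s * C x y)" for x y
    using hermitian_form_cnj[OF B, of y x] hermitian_form_cnj[OF C, of y x] by simp
qed

lemma hermitian_form_zero:
  assumes "hermitian_form B" shows "B (\<lambda>_. 0) y = 0"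
  using hermitian_form_comb[OF assms, of "-1" "\<lambda>_. 0" "\<lambda>_. 0" y] by simp

lemma hermitian_form_lin_comb:
  assumes "hermitian_form B"
  shows "B (lin_comb I c u) y = (\<Sum>i\<in>I. c i * B (u i) y)"
proof (induction I rule: infinite_finite_induct)
  case (insert i I)
  then have "B (lin_comb (insert i I) c u) y = B (\<lambda>n. c i * u i n + lin_comb I c u n) y"
    by (simp add: lin_comb_def [abs_def])
  with insert show ?case by (simp add: hermitian_form_comb[OF assms])
qed (simp_all add: lin_comb_def [abs_def] hermitian_form_zero[OF assms])

lemma hermitian_form_lin_comb_right:
  assumes "hermitian_form B"
  shows "B y (lin_comb I c u) = (\<Sum>i\<in>I. cnj (c i) * B y (u i))"
proof -
  have "B y (lin_comb I c u) = cnj (\<Sum>i\<in>I. c i * B (u i) y)"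
    by (simp only: hermitian_form_cnj[OF assms, of y "lin_comb I c u"] hermitian_form_lin_comb[OF assms])
  also have "\<dots> = (\<Sum>i\<in>I. cnj (c i) * B y (u i))"
    by (simp only: cnj_sum complex_cnj_mult hermitian_form_cnj[OF assms, of y "u _"])
  finally show ?thesis .
qed

lemma hermitian_form_lin_comb_both:
  assumes "hermitian_form B"
  shows "B (lin_comb I c u) (lin_comb I c u) = (\<Sum>i\<in>I. \<Sum>j\<in>I. c i * cnj (c j) * B (u i) (u j))"
  by (subst hermitian_form_lin_comb[OF assms])
     (simp only: hermitian_form_lin_comb_right[OF assms] sum_distrib_left mult.assoc)

lemma hermitian_form_Reals: "hermitian_form B \<Longrightarrow> B x x = of_real (Re (B x x))"
  using hermitian_form_cnj[of B x x] by (simp add: complex_eq_iff)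

lemma lin_comb_unit_vec:
  assumes "finite J" "x \<in> supported J" shows "lin_comb J x unit_vec = x"
  using assms by (auto simp: lin_comb_def unit_vec_def supported_def fun_eq_iff if_distrib cong: if_cong)

lemma lin_comb_supported: "(\<And>i. i \<in> I \<Longrightarrow> u i \<in> supported J) \<Longrightarrow> lin_comb I c u \<in> supported J"
  by (simp add: lin_comb_def supported_def)

lemma hermitian_form_coordinates:
  assumes "hermitian_form B" "finite J" "x \<in> supported J"
  shows "B x y = (\<Sum>n\<in>J. x n * B (unit_vec n) y)"
  using hermitian_form_lin_comb[OF assms(1), of J x unit_vec y] lin_comb_unit_vec[OF assms(2,3)] by simp

lemma hermitian_form_coordinates_both:
  assumes "hermitian_form B" "finite J" "x \<in> supported J"
  shows "B x x = (\<Sum>i\<in>J. \<Sum>j\<in>J. x i * cnj (x j) * B (unit_vec i) (unit_vec j))"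
  using hermitian_form_lin_comb_both[OF assms(1), of J x unit_vec] lin_comb_unit_vec[OF assms(2,3)] by simp

text \<open>Gaussian elimination, one equation and one unknown at a time. It serves three times: to
  find a vector orthogonal to the eigenvectors already constructed, to show that an orthonormal
  family of full size spans, and to intersect subspaces in the min-max test.\<close>

lemma homogeneous_system_nontrivial:
  fixes A :: "'j \<Rightarrow> 'i \<Rightarrow> complex"
  assumes "finite J" "finite I" "card J < card I"
  shows "\<exists>c. (\<exists>i\<in>I. c i \<noteq> 0) \<and> (\<forall>j\<in>J. (\<Sum>i\<in>I. c i * A j i) = 0)"
  using assms
proof (induction J arbitrary: I A rule: finite_induct)
  case empty
  then obtain i where "i \<in> I" by fastforce
  then show ?case by (intro exI[of _ "\<lambda>_. 1"]) auto
next
  case (insert j J)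
  show ?case
  proof (cases "\<forall>i\<in>I. A j i = 0")
    case True
    obtain c where "\<exists>i\<in>I. c i \<noteq> 0" "\<forall>k\<in>J. (\<Sum>i\<in>I. c i * A k i) = 0"
      using insert.IH[of I A] insert.prems insert.hyps by auto
    with True show ?thesis by (intro exI[of _ c]) auto
  next
    case False
    then obtain p where p: "p \<in> I" "A j p \<noteq> 0" by auto
    define I' where "I' = I - {p}"
    have I': "I = insert p I'" "p \<notin> I'" "finite I'" using p insert.prems by (auto simp: I'_def)
    then have "card J < card I'" using insert by simp
    then obtain c where c: "\<exists>i\<in>I'. c i \<noteq> 0"
        "\<forall>k\<in>J. (\<Sum>i\<in>I'. c i * (A k i - A k p * A j i / A j p)) = 0"
      using insert.IH[of I' "\<lambda>k i. A k i - A k p * A j i / A j p"] I' by auto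
    \<comment> \<open>The unknown at the pivot \<open>p\<close> is solved from equation
      \<open>j\<close>; substituting it into equation \<open>k\<close> leaves the reduced system,
      whose coefficients vanish for \<open>k = j\<close>.\<close>
    define d where "d = c(p := - (\<Sum>i\<in>I'. c i * A j i) / A j p)"
    have d: "(\<Sum>i\<in>I. d i * A k i) = (\<Sum>i\<in>I'. c i * (A k i - A k p * A j i / A j p))" for k
    proof -
      have "(\<Sum>i\<in>I. d i * A k i) = d p * A k p + (\<Sum>i\<in>I'. c i * A k i)"
        using I' by (auto simp: d_def intro!: sum.cong)
      also have "d p * A k p = - (\<Sum>i\<in>I'. c i * (A k p * A j i / A j p))"
        by (simp add: d_def sum_distrib_left sum_distrib_right sum_divide_distrib mult_ac)
      finally show ?thesis by (simp add: right_diff_distrib sum_subtractf)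
    qed
    have "(\<Sum>i\<in>I. d i * A j i) = 0" using p by (simp add: d)
    moreover have "\<exists>i\<in>I. d i \<noteq> 0" using c(1) I' by (auto simp: d_def)
    ultimately show ?thesis using c(2) d by (intro exI[of _ d]) auto
  qed
qed

text \<open>Tychonoff's theorem. The unit sphere of \<open>supported J\<close> will be a closed
  subset of this product, so minimisation can stay in the space of all sequences.\<close>

lemma compact_bounded_functions: "compact (PiE UNIV (\<lambda>_. cball 0 1) :: (nat \<Rightarrow> complex) set)"
proof -
  have "compactin (product_topology (\<lambda>_. euclidean) UNIV) (PiE UNIV (\<lambda>_. cball 0 1) :: (nat \<Rightarrow> complex) set)"
    by (subst compactin_PiE) auto
  then show ?thesis by (simp add: euclidean_product_topology)
qed

lemma supported_comb:
  "x \<in> supported J \<Longrightarrow> y \<in> supported J \<Longrightarrow> (\<lambda>n. c * x n + y n) \<in> supported J"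
  by (simp add: supported_def)

text \<open>The Rayleigh quotient attains its minimum on the unit sphere, which is compact in the product
  topology; at a minimum the first variation of \<open>B - l C\<close> vanishes.\<close>

lemma Rayleigh_minimum:
  assumes B: "hermitian_form B" and C: "hermitian_form C" and J: "finite J"
    and pos: "\<And>x. x \<in> supported J \<Longrightarrow> x \<noteq> (\<lambda>_. 0) \<Longrightarrow> 0 < Re (C x x)"
    and S: "S = {x \<in> supported J. \<forall>i<k. C x (v i) = 0}"
    and x0: "x0 \<in> S" "x0 \<noteq> (\<lambda>_. 0)"
  obtains u l where "u \<in> S" "C u u = 1" "\<And>y. y \<in> S \<Longrightarrow> l * Re (C y y) \<le> Re (B y y)"
    "\<And>y. y \<in> S \<Longrightarrow> B u y = of_real l * C u y"
proof -
  define nrm where "nrm x = (\<Sum>n\<in>J. (cmod (x n))\<^sup>2)" for x :: "nat \<Rightarrow> complex"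
  have scale: "(\<lambda>n. c * x n) \<in> S" if "x \<in> S" for c x
    using that hermitian_form_comb[OF C, of c x "\<lambda>_. 0"] hermitian_form_zero[OF C]
    by (auto simp: S supported_def)
  have comb: "(\<lambda>n. c * x n + y n) \<in> S" if "x \<in> S" "y \<in> S" for c x y
    using that hermitian_form_comb[OF C, of c x y] by (auto simp: S supported_def)
  have qscale: "Re (A (\<lambda>n. c * x n) (\<lambda>n. c * x n)) = (cmod c)\<^sup>2 * Re (A x x)"
    if A: "hermitian_form A" for A c x
  proof -
    have "A (\<lambda>n. c * x n) (\<lambda>n. c * x n) = c * (cnj c * A x x)"
      using hermitian_form_comb[OF A, of c x "\<lambda>_. 0"] hermitian_form_zero[OF A]
        hermitian_form_comb_right[OF A, of x c x "\<lambda>_. 0"]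
        hermitian_form_comb_right[OF A, of "\<lambda>_. 0" c x "\<lambda>_. 0"]
        hermitian_form_cnj[OF A, of x "\<lambda>_. 0"]
      by (simp add: hermitian_form_comb[OF A, of c x "\<lambda>_. 0", simplified])
    also have "\<dots> = of_real ((cmod c)\<^sup>2) * A x x"
      by (simp only: complex_norm_square mult.assoc)
    finally show ?thesis by simp
  qed
  \<comment> \<open>The sphere of the coordinate norm bounds every entry by 1. Since it is not the
    sphere of \<open>C\<close>, the quotient of \<open>B\<close> by \<open>C\<close> is minimised
    and the minimiser is normalised for \<open>C\<close> afterwards.\<close>
  define K where "K = {x \<in> S. nrm x = 1}"
  \<comment> \<open>On \<open>supported J\<close> the orthogonality conditions are finite sums of
    coordinates, hence closed conditions in the product topology.\<close>
  have K: "K = (\<Inter>n\<in>-J. {x. x n = 0}) \<inter> (\<Inter>i\<in>{..<k}. {x. (\<Sum>n\<in>J. x n * C (unit_vec n) (v i)) = 0})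
      \<inter> {x. nrm x = 1}" (is "K = ?K'")
  proof (rule set_eqI)
    fix x
    show "x \<in> K \<longleftrightarrow> x \<in> ?K'"
      using hermitian_form_coordinates[OF C J, of x]
      by (cases "x \<in> supported J") (auto simp: K_def S supported_def)
  qed
  have coord: "continuous_on UNIV (\<lambda>x :: nat \<Rightarrow> complex. x n)" for n
    by (rule continuous_on_product_coordinates)
  have "closed ?K'"
    by (intro closed_Int closed_INT ballI closed_Collect_eq)
       (auto simp: nrm_def intro!: continuous_intros coord)
  moreover have "K \<subseteq> PiE UNIV (\<lambda>_. cball 0 1)"
  proof
    fix x assume x: "x \<in> K"
    have "cmod (x n) \<le> 1" for n
    proof (cases "n \<in> J")
      case True
      then have "(cmod (x n))\<^sup>2 \<le> nrm x" unfolding nrm_def by (intro member_le_sum) (use J in auto)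
      then show ?thesis using x by (simp add: K_def abs_square_le_1)
    next
      case False
      then show ?thesis using x by (simp add: K_def S supported_def)
    qed
    then show "x \<in> PiE UNIV (\<lambda>_. cball 0 1)" by auto
  qed
  ultimately have "compact K"
    using compact_Int_closed[OF compact_bounded_functions, of K] K by (simp add: inf.absorb2)
  have cont: "continuous_on K (\<lambda>x. Re (A x x))" if A: "hermitian_form A" for A
  proof -
    have "continuous_on K
        (\<lambda>x. Re (\<Sum>i\<in>J. \<Sum>j\<in>J. x i * cnj (x j) * A (unit_vec i) (unit_vec j)))"
      by (intro continuous_intros continuous_on_subset[OF coord]) auto
    moreover have "A x x = (\<Sum>i\<in>J. \<Sum>j\<in>J. x i * cnj (x j) * A (unit_vec i) (unit_vec j))"
      if "x \<in> K" for x
      using that hermitian_form_coordinates_both[OF A J, of x] by (simp add: K_def S)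
    ultimately show ?thesis by (subst continuous_on_cong[OF refl]) auto
  qed
  have nz: "x \<noteq> (\<lambda>_. 0)" if "nrm x = 1" for x using that by (auto simp: nrm_def)
  have posK: "0 < Re (C x x)" if "x \<in> K" for x
    using that nz pos by (auto simp: K_def S)
  have to_K: "(\<lambda>n. of_real (1 / sqrt (nrm y)) * y n) \<in> K" "0 < nrm y" if y: "y \<in> S" "y \<noteq> (\<lambda>_. 0)" for y
  proof -
    obtain n where "y n \<noteq> 0" using y by auto
    moreover then have "n \<in> J" using y by (auto simp: S supported_def)
    ultimately show p: "0 < nrm y" unfolding nrm_def by (intro sum_pos2[of _ n]) (use J in auto)
    have "nrm (\<lambda>n. of_real (1 / sqrt (nrm y)) * y n) = (\<Sum>n\<in>J. (1 / nrm y) * (cmod (y n))\<^sup>2)"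
      using p unfolding nrm_def[of "\<lambda>n. of_real (1 / sqrt (nrm y)) * y n"]
      by (intro sum.cong) (auto simp: norm_mult norm_divide power_mult_distrib power_divide)
    also have "\<dots> = 1" using p by (simp only: sum_distrib_left[symmetric] nrm_def[symmetric]) simp
    finally show "(\<lambda>n. of_real (1 / sqrt (nrm y)) * y n) \<in> K" using scale[OF y(1)] unfolding K_def by blast
  qed
  have "continuous_on K (\<lambda>x. Re (B x x) / Re (C x x))"
    using posK by (intro continuous_on_divide cont B C) force
  then obtain m where m: "m \<in> K" "\<And>y. y \<in> K \<Longrightarrow> Re (B m m) / Re (C m m) \<le> Re (B y y) / Re (C y y)"
    using continuous_attains_inf[OF \<open>compact K\<close>] to_K(1)[OF x0] by blast
  define l where "l = Re (B m m) / Re (C m m)"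
  define u where "u = (\<lambda>n. of_real (1 / sqrt (Re (C m m))) * m n)"
  have u: "u \<in> S" using m(1) scale unfolding u_def K_def by blast
  have qC: "Re (C u u) = 1" and qB: "Re (B u u) = l"
    using posK[OF m(1)] unfolding u_def
    by (simp_all only: qscale[OF C] qscale[OF B])
       (simp_all add: norm_divide power_divide l_def)
  have "C u u = 1" using qC hermitian_form_Reals[OF C, of u] by simp
  have ineq: "l * Re (C y y) \<le> Re (B y y)" if y: "y \<in> S" for y
  proof (cases "y = (\<lambda>_. 0)")
    case True
    then show ?thesis using hermitian_form_zero[OF B] hermitian_form_zero[OF C] by simp
  next
    case False
    define y' where "y' = (\<lambda>n. of_real (1 / sqrt (nrm y)) * y n)"
    have y': "y' \<in> K" and p: "0 < nrm y" using to_K[OF y False] by (auto simp: y'_def)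
    have "l * Re (C y' y') \<le> Re (B y' y')"
      using m(2)[OF y'] posK[OF y'] by (simp add: l_def pos_le_divide_eq)
    then have "l * ((1 / nrm y) * Re (C y y)) \<le> (1 / nrm y) * Re (B y y)"
      using p unfolding y'_def qscale[OF C] qscale[OF B] by (simp add: norm_divide power_divide)
    then show ?thesis using p by (simp add: field_simps)
  qed
  have crit: "B u y = of_real l * C u y" if y: "y \<in> S" for y
  proof -
    define D where "D x y = B x y - of_real l * C x y" for x y
    have D: "hermitian_form D"
      using hermitian_form_add_scaleR[OF B C, of "- l"] by (simp add: D_def [abs_def])
    have D0: "D u u = 0" using qB \<open>C u u = 1\<close> hermitian_form_Reals[OF B, of u] by (simp add: D_def)
    have Dpos: "0 \<le> Re (D x x)" if "x \<in> S" for x using ineq[OF that] by (simp add: D_def)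
    define a where "a = D u y"
    define r where "r = Re (D y y)"
    have "0 \<le> 2 * s * (cmod a)\<^sup>2 + r" for s :: real
    proof -
      \<comment> \<open>The factor \<open>cnj a\<close> makes \<open>c * a\<close> real, so the
        first variation along \<open>c * u + y\<close> is an affine function of \<open>s\<close>
        with slope proportional to the square of \<open>cmod a\<close>.\<close>
      define c where "c = of_real s * cnj a"
      have "D (\<lambda>n. c * u n + y n) (\<lambda>n. c * u n + y n) = c * a + (cnj c * cnj a + D y y)"
        by (simp add: hermitian_form_comb[OF D] hermitian_form_comb_right[OF D] D0 a_def
              hermitian_form_cnj[OF D, of y u])
      moreover have "c * a = of_real (s * (cmod a)\<^sup>2)"
        by (simp only: c_def of_real_mult complex_norm_square mult_ac)
      moreover have "cnj c * cnj a = of_real (s * (cmod a)\<^sup>2)"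
        by (simp only: c_def of_real_mult complex_norm_square complex_cnj_mult complex_cnj_cnj
              complex_cnj_complex_of_real mult_ac)
      ultimately have "Re (D (\<lambda>n. c * u n + y n) (\<lambda>n. c * u n + y n)) = 2 * s * (cmod a)\<^sup>2 + r"
        by (simp only: r_def) (simp del: of_real_mult)
      then show ?thesis using Dpos[OF comb[OF u y]] by metis
    qed
    \<comment> \<open>Unless \<open>a = 0\<close>, this \<open>s\<close> makes the nonnegative
      quantity equal to -1.\<close>
    from this[of "- (r + 1) / (2 * (cmod a)\<^sup>2)"] have "a = 0" by (cases "a = 0") (auto simp: field_simps)
    then show ?thesis by (simp add: a_def D_def)
  qed
  show ?thesis using that[OF u \<open>C u u = 1\<close> ineq crit] .
qed

section \<open>Simultaneous diagonalization\<close>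

text \<open>The eigenvalue equation is weak: it is tested only against \<open>supported J\<close>,
  so for a smaller \<open>J\<close> it describes the compressed pencil. Only the values of
  \<open>v\<close> and \<open>l\<close> below \<open>card J\<close> are constrained.\<close>

definition diagonalized where
  "diagonalized J B C v l \<longleftrightarrow>
     (\<forall>i<card J. v i \<in> supported J) \<and>
     (\<forall>i<card J. \<forall>j<card J. C (v i) (v j) = (if i = j then 1 else 0)) \<and>
     (\<forall>i<card J. \<forall>y\<in>supported J. B (v i) y = complex_of_real (l i) * C (v i) y) \<and>
     (\<forall>i j. i \<le> j \<and> j < card J \<longrightarrow> l i \<le> l j) \<and>
     (\<forall>y\<in>supported J. lin_comb {..<card J} (\<lambda>i. C y (v i)) v = y)"

lemma orthonormal_coefficient:
  fixes k :: nat
  assumes "hermitian_form C" "\<forall>i<k. \<forall>j<k. C (v i) (v j) = (if i = j then 1 else 0)" "j < k"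
  shows "C (lin_comb {..<k} c v) (v j) = c j"
proof -
  have "C (lin_comb {..<k} c v) (v j) = (\<Sum>i<k. if i = j then c i else 0)"
    unfolding hermitian_form_lin_comb[OF assms(1)] by (intro sum.cong) (use assms in auto)
  then show ?thesis using assms(3) by simp
qed

text \<open>Together with \<open>y\<close> there are \<open>card J + 1\<close> vectors in a space of
  dimension \<open>card J\<close>, hence a nontrivial relation. Orthonormality forbids a relation
  without \<open>y\<close>, and pairing with \<open>v i\<close> identifies the coefficients.\<close>

lemma orthonormal_basis_expansion:
  assumes C: "hermitian_form C" and J: "finite J"
    and v: "\<forall>i<card J. v i \<in> supported J"
    and orth: "\<forall>i<card J. \<forall>j<card J. C (v i) (v j) = (if i = j then 1 else 0)"
    and y: "y \<in> supported J"
  shows "lin_comb {..<card J} (\<lambda>i. C y (v i)) v = y"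
proof -
  define u where "u = v(card J := y)"
  obtain c where c: "\<exists>i\<in>{..card J}. c i \<noteq> 0" "\<forall>n\<in>J. (\<Sum>i\<in>{..card J}. c i * u i n) = 0"
    using homogeneous_system_nontrivial[of J "{..card J}" "\<lambda>n i. u i n"] J by auto
  have "lin_comb {..card J} c u n = 0" for n
    using c(2) v y by (cases "n \<in> J") (auto simp: lin_comb_def u_def supported_def intro!: sum.neutral)
  then have z: "lin_comb {..<card J} c v n + c (card J) * y n = 0" for n
    by (simp add: lin_comb_def lessThan_Suc_atMost[symmetric] u_def)
  have cz: "c (card J) \<noteq> 0"
  proof
    assume 0: "c (card J) = 0"
    then have "lin_comb {..<card J} c v = (\<lambda>_. 0)" using z by (simp add: fun_eq_iff)
    then have "c j = 0" if "j < card J" for j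
      using orthonormal_coefficient[OF C orth that, of c] by (simp add: hermitian_form_zero[OF C])
    then show False using c(1) 0 by (metis atMost_iff le_neq_implies_less)
  qed
  define b where "b = (\<lambda>i. - c i / c (card J))"
  have yb: "y = lin_comb {..<card J} b v"
  proof
    fix n
    have "lin_comb {..<card J} b v n = - lin_comb {..<card J} c v n / c (card J)"
      by (simp add: b_def lin_comb_def sum_divide_distrib sum_negf)
    also have "\<dots> = y n" using z[of n] cz by (simp add: field_simps add_eq_0_iff)
    finally show "y n = lin_comb {..<card J} b v n" ..
  qed
  have "C y (v i) = b i" if "i < card J" for i
    unfolding yb by (rule orthonormal_coefficient[OF C orth that])
  then have "lin_comb {..<card J} (\<lambda>i. C y (v i)) v n = lin_comb {..<card J} b v n" for n
    by (simp add: lin_comb_def)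
  with yb show ?thesis by auto
qed

text \<open>Eigenvectors are found one by one, by minimising the Rayleigh quotient on the
  \<open>C\<close>-orthogonal complement of those already found.\<close>

theorem hermitian_pencil_diagonalizable:
  assumes B: "hermitian_form B" and C: "hermitian_form C" and J: "finite J"
    and pos: "\<And>x. x \<in> supported J \<Longrightarrow> x \<noteq> (\<lambda>_. 0) \<Longrightarrow> 0 < Re (C x x)"
  shows "\<exists>v l. diagonalized J B C v l"
proof -
  \<comment> \<open>The last clause is the extra induction load: each earlier \<open>l i\<close>
    bounds the quotient from below on the current complement. Applied to the next eigenvector it
    yields the ordering.\<close>
  define P where "P k v l \<longleftrightarrow>
     (\<forall>i<k. v i \<in> supported J) \<and>
     (\<forall>i<k. \<forall>j<k. C (v i) (v j) = (if i = j then 1 else 0)) \<and>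
     (\<forall>i<k. \<forall>y\<in>supported J. B (v i) y = complex_of_real (l i) * C (v i) y) \<and>
     (\<forall>i j. i \<le> j \<and> j < k \<longrightarrow> l i \<le> l j) \<and>
     (\<forall>y\<in>supported J. (\<forall>i<k. C y (v i) = 0) \<longrightarrow> (\<forall>i<k. l i * Re (C y y) \<le> Re (B y y)))"
    for k and v :: "nat \<Rightarrow> nat \<Rightarrow> complex" and l
  have "\<exists>v l. P k v l" if "k \<le> card J" for k
    using that
  proof (induction k)
    case 0
    show ?case by (auto simp: P_def)
  next
    case (Suc k)
    then obtain v l where vl: "P k v l" by auto
    have v: "v i \<in> supported J" if "i < k" for i using vl that by (simp add: P_def)
    have orth: "\<forall>i<k. \<forall>j<k. C (v i) (v j) = (if i = j then 1 else 0)"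
      using vl by (simp add: P_def)
    have eig: "B (v i) y = complex_of_real (l i) * C (v i) y" if "i < k" "y \<in> supported J" for i y
      using vl that by (simp add: P_def)
    obtain c where c: "\<exists>n\<in>J. c n \<noteq> 0" "\<forall>i\<in>{..<k}. (\<Sum>n\<in>J. c n * C (unit_vec n) (v i)) = 0"
      using homogeneous_system_nontrivial[of "{..<k}" J "\<lambda>i n. C (unit_vec n) (v i)"] J Suc.prems by auto
    define x0 where "x0 = (\<lambda>n. if n \<in> J then c n else 0)"
    have x0S: "x0 \<in> supported J" by (simp add: x0_def supported_def)
    have "C x0 (v i) = 0" if "i < k" for i
    proof -
      have "C x0 (v i) = (\<Sum>n\<in>J. c n * C (unit_vec n) (v i))"
        unfolding hermitian_form_coordinates[OF C J x0S] by (intro sum.cong) (auto simp: x0_def)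
      with c(2) that show ?thesis by simp
    qed
    then have x0: "x0 \<in> {x \<in> supported J. \<forall>i<k. C x (v i) = 0}" using x0S by blast
    have "\<exists>n. x0 n \<noteq> 0" using c(1) by (auto simp: x0_def)
    then have x0nz: "x0 \<noteq> (\<lambda>_. 0)" by auto
    obtain u m where u: "u \<in> {x \<in> supported J. \<forall>i<k. C x (v i) = 0}" "C u u = 1"
      and m: "\<And>y. y \<in> {x \<in> supported J. \<forall>i<k. C x (v i) = 0} \<Longrightarrow> m * Re (C y y) \<le> Re (B y y)"
      and Bu: "\<And>y. y \<in> {x \<in> supported J. \<forall>i<k. C x (v i) = 0} \<Longrightarrow> B u y = of_real m * C u y"
      by (rule Rayleigh_minimum[OF B C J pos refl x0 x0nz]) blast+
    have uv: "C u (v i) = 0" "C (v i) u = 0" if "i < k" for i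
      using u that hermitian_form_cnj[OF C, of "v i" u] by auto
    have uS: "u \<in> supported J" using u by auto
    have Bu': "B u y = of_real m * C u y" if y: "y \<in> supported J" for y
    proof -
      \<comment> \<open>The minimum gives the eigenvalue equation only against the complement. An
        arbitrary \<open>y\<close> splits into \<open>s\<close>, in the span of the earlier
        eigenvectors, where both sides vanish, and the remainder \<open>r\<close> in the
        complement.\<close>
      define s where "s = lin_comb {..<k} (\<lambda>i. C y (v i)) v"
      define r where "r = (\<lambda>n. -1 * s n + y n)"
      have sS: "s \<in> supported J" unfolding s_def by (intro lin_comb_supported v) auto
      have "r \<in> supported J" unfolding r_def by (intro supported_comb sS y)
      moreover have "C r (v i) = 0" if "i < k" for i
        unfolding r_def hermitian_form_comb[OF C] s_def orthonormal_coefficient[OF C orth that] by simp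
      ultimately have "B u r = of_real m * C u r" using Bu by auto
      moreover have "B u (v i) = 0" if "i < k" for i
        using eig[OF that uS] uv[OF that] hermitian_form_cnj[OF B, of u "v i"] by simp
      then have "B u s = 0" "C u s = 0"
        using uv by (auto simp: s_def hermitian_form_lin_comb_right[OF B] hermitian_form_lin_comb_right[OF C])
      ultimately show ?thesis
        using hermitian_form_comb_right[OF B, of u "-1" s y] hermitian_form_comb_right[OF C, of u "-1" s y]
        by (simp add: r_def)
    qed
    have mono: "l i \<le> l j" if "i \<le> j" "j < k" for i j using vl that by (simp add: P_def)
    have low: "l i * Re (C y y) \<le> Re (B y y)" if "y \<in> supported J" "\<forall>i<k. C y (v i) = 0" "i < k" for i y
      using vl that by (simp add: P_def)
    have lm: "l i \<le> m" if "i < k" for i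
      using low[OF uS _ that] uv Bu'[OF uS] u(2) by simp
    have "P (Suc k) (v(k := u)) (l(k := m))"
      unfolding P_def
    proof (intro conjI allI impI ballI)
      fix i assume i: "i < Suc k"
      show "(v(k := u)) i \<in> supported J" using i v uS by (auto simp: less_Suc_eq)
      show "C ((v(k := u)) i) ((v(k := u)) j) = (if i = j then 1 else 0)" if "j < Suc k" for j
        using i that orth uv u(2) by (auto simp: less_Suc_eq)
      show "B ((v(k := u)) i) y = complex_of_real ((l(k := m)) i) * C ((v(k := u)) i) y"
        if "y \<in> supported J" for y
        using i that eig Bu' by (auto simp: less_Suc_eq)
      show "(l(k := m)) i * Re (C y y) \<le> Re (B y y)"
        if "y \<in> supported J" and y: "\<forall>i<Suc k. C y ((v(k := u)) i) = 0" for y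
      proof -
        have *: "C y (v j) = 0" if "j < k" for j using y that by (auto dest!: spec[of _ j])
        show ?thesis
        proof (cases "i = k")
          case True
          then show ?thesis using m[of y] that * by simp
        next
          case False
          then show ?thesis using low[of y i] that * i by simp
        qed
      qed
    next
      fix i j assume "i \<le> j \<and> j < Suc k"
      then show "(l(k := m)) i \<le> (l(k := m)) j"
        using lm mono by (auto simp: less_Suc_eq)
    qed
    then show ?case by blast
  qed
  from this[OF order_refl] obtain v l where "P (card J) v l" by auto
  then have "diagonalized J B C v l"
    using orthonormal_basis_expansion[OF C J, of v] by (simp add: P_def diagonalized_def)
  then show ?thesis by blast
qed

lemma diagonalized_quadratic:
  assumes C: "hermitian_form C" and B: "hermitian_form B" and d: "diagonalized J B C v l"
    and y: "y \<in> supported J"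
  shows "Re (C y y) = (\<Sum>i<card J. (cmod (C y (v i)))\<^sup>2)"
    and "Re (B y y) = (\<Sum>i<card J. l i * (cmod (C y (v i)))\<^sup>2)"
proof -
  have y': "y = lin_comb {..<card J} (\<lambda>i. C y (v i)) v" using d y by (simp add: diagonalized_def)
  have vy: "C (v i) y = cnj (C y (v i))" for i by (rule hermitian_form_cnj[OF C])
  have "C y y = C (lin_comb {..<card J} (\<lambda>i. C y (v i)) v) y" using y' by simp
  also have "\<dots> = (\<Sum>i<card J. C y (v i) * cnj (C y (v i)))"
    by (simp only: hermitian_form_lin_comb[OF C] vy)
  also have "\<dots> = of_real (\<Sum>i<card J. (cmod (C y (v i)))\<^sup>2)"
    by (simp only: of_real_sum complex_norm_square)
  finally show "Re (C y y) = (\<Sum>i<card J. (cmod (C y (v i)))\<^sup>2)" by simp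
  have "B y y = B (lin_comb {..<card J} (\<lambda>i. C y (v i)) v) y" using y' by simp
  also have "\<dots> = (\<Sum>i<card J. of_real (l i) * (C y (v i) * cnj (C y (v i))))"
    unfolding hermitian_form_lin_comb[OF B]
    by (intro sum.cong) (use d y in \<open>auto simp: diagonalized_def vy\<close>)
  also have "\<dots> = of_real (\<Sum>i<card J. l i * (cmod (C y (v i)))\<^sup>2)"
    by (simp only: of_real_sum of_real_mult complex_norm_square)
  finally show "Re (B y y) = (\<Sum>i<card J. l i * (cmod (C y (v i)))\<^sup>2)" by simp
qed

text \<open>One half of the Courant--Fischer principle: the span of the \<open>u i\<close> is too large to avoid the span of the eigenvectors from the \<open>n\<close>-th on.\<close>

lemma eigenvalue_less_test:
  assumes B: "hermitian_form B" and C: "hermitian_form C" and d: "diagonalized J B C v l"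
    and n: "n < card J" and I: "finite I" "n < card I" and u: "\<And>i. i \<in> I \<Longrightarrow> u i \<in> supported J"
    and test: "\<And>c. \<exists>i\<in>I. c i \<noteq> 0 \<Longrightarrow>
       Re (B (lin_comb I c u) (lin_comb I c u)) < t * Re (C (lin_comb I c u) (lin_comb I c u))"
  shows "l n < t"
proof (rule ccontr)
  assume t: "\<not> l n < t"
  obtain c where c: "\<exists>i\<in>I. c i \<noteq> 0" "\<forall>j\<in>{..<n}. (\<Sum>i\<in>I. c i * C (u i) (v j)) = 0"
    using homogeneous_system_nontrivial[of "{..<n}" I "\<lambda>j i. C (u i) (v j)"] I by auto
  define y where "y = lin_comb I c u"
  have y: "y \<in> supported J" unfolding y_def by (intro lin_comb_supported u)
  have z: "C y (v j) = 0" if "j < n" for j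
    using c(2) that by (simp add: y_def hermitian_form_lin_comb[OF C])
  have "t * Re (C y y) \<le> Re (B y y)"
    unfolding diagonalized_quadratic[OF C B d y] sum_distrib_left
  proof (intro sum_mono)
    fix i assume i: "i \<in> {..<card J}"
    show "t * (cmod (C y (v i)))\<^sup>2 \<le> l i * (cmod (C y (v i)))\<^sup>2"
    proof (cases "i < n")
      case False
      then have "l n \<le> l i" using d i by (simp add: diagonalized_def)
      then show ?thesis using t by (intro mult_right_mono) auto
    qed (simp add: z)
  qed
  then show False using test[OF c(1)] by (simp add: y_def)
qed

text \<open>Negation reverses the order of the eigenvalues. Through it the test for
  \<open>l n < t\<close> also yields bounds from below, so only one half of the min-max principle
  has to be proved.\<close>

lemma diagonalized_uminus:
  assumes d: "diagonalized J B C v l"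
  shows "diagonalized J (\<lambda>x y. - B x y) C (\<lambda>i. v (card J - Suc i)) (\<lambda>i. - l (card J - Suc i))"
proof -
  have "lin_comb {..<card J} (\<lambda>i. C y (v (card J - Suc i))) (\<lambda>i. v (card J - Suc i)) =
      lin_comb {..<card J} (\<lambda>i. C y (v i)) v" for y
  proof
    fix n
    show "lin_comb {..<card J} (\<lambda>i. C y (v (card J - Suc i))) (\<lambda>i. v (card J - Suc i)) n =
      lin_comb {..<card J} (\<lambda>i. C y (v i)) v n"
      unfolding lin_comb_def by (rule sum.nat_diff_reindex[where g="\<lambda>i. C y (v i) * v i n"])
  qed
  with d show ?thesis by (auto simp: diagonalized_def)
qed

section \<open>Perturbation of eigenvalues\<close>

text \<open>The limit matrix is diagonal with entries at most \<open>- \<delta>\<close>. Entrywise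
  closeness spoils the form by at most half of \<delta> times the squared length of
  \<open>c\<close>, uniformly in \<open>c\<close>.\<close>

lemma eventually_form_negative:
  fixes M :: "'p \<Rightarrow> 'i \<Rightarrow> 'i \<Rightarrow> complex"
  assumes I: "finite I" and \<delta>: "\<delta> > 0" and m: "\<And>i. i \<in> I \<Longrightarrow> m i \<le> - \<delta>"
    and lim: "\<And>i j. i \<in> I \<Longrightarrow> j \<in> I \<Longrightarrow> ((\<lambda>p. M p i j) \<longlongrightarrow> (if i = j then of_real (m i) else 0)) F"
  shows "\<forall>\<^sub>F p in F. \<forall>c. Re (\<Sum>i\<in>I. \<Sum>j\<in>I. c i * cnj (c j) * M p i j) \<le> - (\<delta> / 2) * (\<Sum>i\<in>I. (cmod (c i))\<^sup>2)"
proof -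
  \<comment> \<open>Summing the errors over all pairs costs a factor \<open>card I\<close>, which
    this choice reduces to half of \<delta>; the added 1 keeps the denominator positive for empty
    \<open>I\<close>.\<close>
  define \<eta> where "\<eta> = \<delta> / (2 * (real (card I) + 1))"
  have \<eta>: "\<eta> > 0" "real (card I) * \<eta> \<le> \<delta> / 2"
    using \<delta> by (auto simp: \<eta>_def field_simps)
  have "\<forall>\<^sub>F p in F. \<forall>i\<in>I. \<forall>j\<in>I. dist (M p i j) (if i = j then of_real (m i) else 0) < \<eta>"
    using lim \<eta>(1) by (intro eventually_ball_finite ballI I tendstoD) auto
  then show ?thesis
  proof eventually_elim
    case (elim p)
    show ?case
    proof
      fix c :: "'i \<Rightarrow> complex"
      define S where "S = (\<Sum>i\<in>I. (cmod (c i))\<^sup>2)"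
      have S: "0 \<le> S" by (simp add: S_def sum_nonneg)
      have "Re (c i * cnj (c j) * M p i j) \<le>
          (if i = j then m i * (cmod (c i))\<^sup>2 else 0) + (\<eta> / 2 * (cmod (c i))\<^sup>2 + \<eta> / 2 * (cmod (c j))\<^sup>2)"
        if ij: "i \<in> I" "j \<in> I" for i j
      proof -
        define E where "E = M p i j - (if i = j then of_real (m i) else 0)"
        have E: "cmod E \<le> \<eta>" using elim ij by (force simp: E_def dist_norm)
        have "c i * cnj (c j) * M p i j =
            (if i = j then of_real (m i * (cmod (c i))\<^sup>2) else 0) + c i * cnj (c j) * E"
          by (auto simp: E_def algebra_simps complex_norm_square simp flip: of_real_power)
        then have eq: "Re (c i * cnj (c j) * M p i j) =
            (if i = j then m i * (cmod (c i))\<^sup>2 else 0) + Re (c i * cnj (c j) * E)"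
          by simp
        have "Re (c i * cnj (c j) * E) \<le> cmod (c i * cnj (c j) * E)" by (rule complex_Re_le_cmod)
        also have "\<dots> \<le> (cmod (c i) * cmod (c j)) * \<eta>"
          unfolding norm_mult complex_mod_cnj by (intro mult_left_mono E) auto
        also have "\<dots> \<le> (((cmod (c i))\<^sup>2 + (cmod (c j))\<^sup>2) / 2) * \<eta>"
          using sum_squares_bound[of "cmod (c i)" "cmod (c j)"] \<eta>(1) by (intro mult_right_mono) auto
        also have "(((cmod (c i))\<^sup>2 + (cmod (c j))\<^sup>2) / 2) * \<eta> = \<eta> / 2 * (cmod (c i))\<^sup>2 + \<eta> / 2 * (cmod (c j))\<^sup>2"
          by (simp add: field_simps)
        finally show ?thesis unfolding eq by (rule add_left_mono)
      qed
      then have "Re (\<Sum>i\<in>I. \<Sum>j\<in>I. c i * cnj (c j) * M p i j) \<le> (\<Sum>i\<in>I. \<Sum>j\<in>I.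
          (if i = j then m i * (cmod (c i))\<^sup>2 else 0) + (\<eta> / 2 * (cmod (c i))\<^sup>2 + \<eta> / 2 * (cmod (c j))\<^sup>2))"
        unfolding Re_sum by (intro sum_mono)
      also have "\<dots> = (\<Sum>i\<in>I. m i * (cmod (c i))\<^sup>2) + real (card I) * \<eta> * S"
        using I by (simp add: sum.distrib S_def sum_distrib_left sum.delta algebra_simps)
      also have "\<dots> \<le> (\<Sum>i\<in>I. - \<delta> * (cmod (c i))\<^sup>2) + \<delta> / 2 * S"
        using m \<eta>(2) S by (intro add_mono sum_mono mult_right_mono) auto
      also have "\<dots> = - (\<delta> / 2) * S"
        by (simp add: sum_distrib_left[symmetric] S_def[symmetric] sum_negf)
      finally show "Re (\<Sum>i\<in>I. \<Sum>j\<in>I. c i * cnj (c j) * M p i j) \<le> - (\<delta> / 2) * (\<Sum>i\<in>I. (cmod (c i))\<^sup>2)"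
        by (simp add: S_def)
    qed
  qed
qed

text \<open>In the extra direction \<open>a\<close> the matrix is merely bounded, without a sign,
  but \<open>s p\<close> tends to minus infinity there. Young's inequality splits each cross term
  into a small part, absorbed by the negative form on \<open>I\<close>, and a large multiple of the
  square of \<open>cmod (c a)\<close>, absorbed by \<open>s p\<close>.\<close>

lemma eventually_form_negative_singular:
  fixes M :: "'p \<Rightarrow> 'i \<Rightarrow> 'i \<Rightarrow> complex" and s :: "'p \<Rightarrow> real"
  assumes I: "finite I" "a \<notin> I" and \<delta>: "\<delta> > 0" and m: "\<And>i. i \<in> I \<Longrightarrow> m i \<le> - \<delta>"
    and lim: "\<And>i j. i \<in> I \<Longrightarrow> j \<in> I \<Longrightarrow> ((\<lambda>p. M p i j) \<longlongrightarrow> (if i = j then of_real (m i) else 0)) F"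
    and lim_a: "\<And>i j. i \<in> insert a I \<Longrightarrow> j \<in> insert a I \<Longrightarrow> ((\<lambda>p. M p i j) \<longlongrightarrow> M0 i j) F"
    and s: "filterlim s at_bot F"
  shows "\<forall>\<^sub>F p in F. \<forall>c. (\<exists>i\<in>insert a I. c i \<noteq> 0) \<longrightarrow>
     Re (\<Sum>i\<in>insert a I. \<Sum>j\<in>insert a I. c i * cnj (c j) * M p i j) + s p * (cmod (c a))\<^sup>2 < 0"
proof -
  define k where "k = 1 + (\<Sum>i\<in>insert a I. \<Sum>j\<in>insert a I. cmod (M0 i j))"
  have k: "cmod (M0 i j) < k" if "i \<in> insert a I" "j \<in> insert a I" for i j
  proof -
    have "cmod (M0 i j) \<le> (\<Sum>j\<in>insert a I. cmod (M0 i j))"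
      using that I by (intro member_le_sum[where f="\<lambda>j. cmod (M0 i j)"]) auto
    also have "\<dots> \<le> (\<Sum>i\<in>insert a I. \<Sum>j\<in>insert a I. cmod (M0 i j))"
      using that I by (intro member_le_sum[where f="\<lambda>i. \<Sum>j\<in>insert a I. cmod (M0 i j)"]) (auto intro!: add_nonneg_nonneg sum_nonneg)
    finally show ?thesis by (simp add: k_def)
  qed
  \<comment> \<open>The total coefficient of the square of \<open>cmod (c a)\<close>: the diagonal
    entry contributes at most \<open>k\<close>, and each of the \<open>card I\<close> cross terms
    the Young constant.\<close>
  define b where "b = k + real (card I) * (4 * k\<^sup>2 / \<delta>)"
  have "\<forall>\<^sub>F p in F. \<forall>i\<in>insert a I. \<forall>j\<in>insert a I. cmod (M p i j) < k"
    using I k by (intro eventually_ball_finite ballI order_tendstoD[OF tendsto_norm[OF lim_a]]) auto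
  moreover have "\<forall>\<^sub>F p in F. s p \<le> - b - 1" using s by (simp add: filterlim_at_bot)
  moreover have "\<forall>\<^sub>F p in F. \<forall>c. Re (\<Sum>i\<in>I. \<Sum>j\<in>I. c i * cnj (c j) * M p i j) \<le>
      - (\<delta> / 2) * (\<Sum>i\<in>I. (cmod (c i))\<^sup>2)"
    by (rule eventually_form_negative[OF I(1) \<delta> m lim])
  ultimately show ?thesis
  proof eventually_elim
    case (elim p)
    show ?case
    proof (intro allI impI)
      fix c :: "'i \<Rightarrow> complex" assume c: "\<exists>i\<in>insert a I. c i \<noteq> 0"
      define S where "S = (\<Sum>i\<in>I. (cmod (c i))\<^sup>2)"
      define T where "T i j = c i * cnj (c j) * M p i j" for i j
      have T: "Re (T i j) \<le> cmod (c i) * cmod (c j) * k" if "i \<in> insert a I" "j \<in> insert a I" for i j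
      proof -
        have "Re (T i j) \<le> cmod (T i j)" by (rule complex_Re_le_cmod)
        also have "\<dots> \<le> cmod (c i) * cmod (c j) * k"
          unfolding T_def norm_mult complex_mod_cnj
          by (intro mult_left_mono) (use elim that in force)+
        finally show ?thesis .
      qed
      have cross: "Re (T a j) + Re (T j a) \<le> \<delta> / 4 * (cmod (c j))\<^sup>2 + (4 * k\<^sup>2 / \<delta>) * (cmod (c a))\<^sup>2" if "j \<in> I" for j
      proof -
        have "Re (T a j) + Re (T j a) \<le> 2 * (cmod (c a) * cmod (c j) * k)"
          using T[of a j] T[of j a] that by (simp add: mult_ac)
        also have "\<dots> \<le> \<delta> / 4 * (cmod (c j))\<^sup>2 + (4 * k\<^sup>2 / \<delta>) * (cmod (c a))\<^sup>2"
        proof -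
          \<comment> \<open>The square is weighted so that each cross term uses up \<delta>/4, half
            of the available \<delta>/2.\<close>
          have "0 \<le> (\<delta> * cmod (c j) - 4 * k * cmod (c a))\<^sup>2 / (4 * \<delta>)" using \<delta> by simp
          also have "\<dots> = \<delta> / 4 * (cmod (c j))\<^sup>2 + (4 * k\<^sup>2 / \<delta>) * (cmod (c a))\<^sup>2 - 2 * (cmod (c a) * cmod (c j) * k)"
            using \<delta> by (simp add: power2_eq_square field_simps)
          finally show ?thesis by simp
        qed
        finally show ?thesis .
      qed
      have "Re (\<Sum>i\<in>insert a I. \<Sum>j\<in>insert a I. T i j) =
          Re (T a a) + (\<Sum>j\<in>I. Re (T a j) + Re (T j a)) + Re (\<Sum>i\<in>I. \<Sum>j\<in>I. T i j)"
        using I by (simp add: sum.distrib)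
      also have "\<dots> \<le> k * (cmod (c a))\<^sup>2 + (\<Sum>j\<in>I. \<delta> / 4 * (cmod (c j))\<^sup>2 + (4 * k\<^sup>2 / \<delta>) * (cmod (c a))\<^sup>2)
          + - (\<delta> / 2) * S"
      proof (rule add_mono[OF add_mono[OF _ sum_mono[OF cross]]])
        show "Re (T a a) \<le> k * (cmod (c a))\<^sup>2"
          using T[of a a] by (simp only: insertI1 power2_eq_square mult_ac)
        show "Re (\<Sum>i\<in>I. \<Sum>j\<in>I. T i j) \<le> - (\<delta> / 2) * S"
          unfolding T_def S_def using elim(3) by blast
      qed
      also have "\<dots> = b * (cmod (c a))\<^sup>2 - \<delta> / 4 * S"
        by (simp only: sum.distrib sum_distrib_left[symmetric] S_def[symmetric] sum_constant b_def) (simp add: algebra_simps)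
      finally have "Re (\<Sum>i\<in>insert a I. \<Sum>j\<in>insert a I. T i j) + s p * (cmod (c a))\<^sup>2 \<le>
          (b + s p) * (cmod (c a))\<^sup>2 - \<delta> / 4 * S" by (simp add: algebra_simps)
      also have "\<dots> \<le> - ((cmod (c a))\<^sup>2 + \<delta> / 4 * S)"
        using mult_right_mono[of "b + s p" "-1" "(cmod (c a))\<^sup>2"] elim(2) by simp
      also have "\<dots> < 0"
      proof (cases "c a = 0")
        case True
        then obtain i where i: "i \<in> I" "c i \<noteq> 0" using c by auto
        then have "S > 0" unfolding S_def using I by (intro sum_pos2[of _ i]) auto
        then show ?thesis using \<delta> True by simp
      next
        case False
        have "0 \<le> \<delta> / 4 * S" using \<delta> by (simp add: S_def sum_nonneg)
        moreover have "0 < (cmod (c a))\<^sup>2" using False by simp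
        ultimately show ?thesis by linarith
      qed
      finally show "Re (\<Sum>i\<in>insert a I. \<Sum>j\<in>insert a I. c i * cnj (c j) * M p i j) + s p * (cmod (c a))\<^sup>2 < 0"
        by (simp add: T_def)
    qed
  qed
qed

text \<open>The test space is spanned by the limit eigenvectors with index up to \<open>n\<close>;
  on it \<open>H p - t * C p\<close> tends to the diagonal matrix of the negative numbers
  \<open>l0 i - t\<close>. Convergence is required on \<open>supported J0\<close> only, which makes
  the lemma applicable to a penalised form that blows up outside the hyperplane.\<close>

lemma diagonalized_less_eventually:
  fixes H C :: "'p \<Rightarrow> (nat \<Rightarrow> complex) \<Rightarrow> (nat \<Rightarrow> complex) \<Rightarrow> complex"
  assumes H: "\<And>p. hermitian_form (H p)" and C: "\<And>p. hermitian_form (C p)"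
    and J: "finite J" "J0 \<subseteq> J"
    and d0: "diagonalized J0 B0 C0 v0 l0"
    and d: "\<forall>\<^sub>F p in F. \<exists>v. diagonalized J (H p) (C p) v (l p)"
    and limH: "\<And>x y. x \<in> supported J0 \<Longrightarrow> y \<in> supported J0 \<Longrightarrow> ((\<lambda>p. H p x y) \<longlongrightarrow> B0 x y) F"
    and limC: "\<And>x y. x \<in> supported J0 \<Longrightarrow> y \<in> supported J0 \<Longrightarrow> ((\<lambda>p. C p x y) \<longlongrightarrow> C0 x y) F"
    and n: "n < card J0" "l0 n < t"
  shows "\<forall>\<^sub>F p in F. l p n < t"
proof -
  have v0: "v0 i \<in> supported J0" if "i \<le> n" for i using d0 n that by (simp add: diagonalized_def)
  have nJ: "n < card J" using n card_mono[OF J] by simp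
  have lim: "((\<lambda>p. H p (v0 i) (v0 j) - of_real t * C p (v0 i) (v0 j)) \<longlongrightarrow>
      (if i = j then of_real (l0 i - t) else 0)) F" if "i \<in> {..n}" "j \<in> {..n}" for i j
  proof -
    have "B0 (v0 i) (v0 j) - of_real t * C0 (v0 i) (v0 j) = (if i = j then of_real (l0 i - t) else 0)"
      using d0 n that v0 by (simp add: diagonalized_def)
    moreover have "((\<lambda>p. H p (v0 i) (v0 j) - of_real t * C p (v0 i) (v0 j)) \<longlongrightarrow>
        B0 (v0 i) (v0 j) - of_real t * C0 (v0 i) (v0 j)) F"
      using that by (intro tendsto_intros limH limC v0) auto
    ultimately show ?thesis by simp
  qed
  have "\<forall>\<^sub>F p in F. \<forall>c. Re (\<Sum>i\<in>{..n}. \<Sum>j\<in>{..n}. c i * cnj (c j) *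
      (H p (v0 i) (v0 j) - of_real t * C p (v0 i) (v0 j))) \<le> - ((t - l0 n) / 2) * (\<Sum>i\<in>{..n}. (cmod (c i))\<^sup>2)"
    by (rule eventually_form_negative[where m="\<lambda>i. l0 i - t"])
       (use n d0 lim in \<open>auto simp: diagonalized_def\<close>)
  with d show ?thesis
  proof eventually_elim
    case (elim p)
    then obtain v where v: "diagonalized J (H p) (C p) v (l p)" by auto
    show ?case
    proof (rule eigenvalue_less_test[OF H C v nJ, of "{..n}" v0])
      show "v0 i \<in> supported J" if "i \<in> {..n}" for i using v0[of i] that J by (auto simp: supported_def)
      fix c :: "nat \<Rightarrow> complex" assume "\<exists>i\<in>{..n}. c i \<noteq> 0"
      then obtain i where i: "i \<in> {..n}" "c i \<noteq> 0" by auto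
      then have "0 < (\<Sum>i\<in>{..n}. (cmod (c i))\<^sup>2)" by (intro sum_pos2[of _ i]) auto
      then have "0 < ((t - l0 n) / 2) * (\<Sum>i\<in>{..n}. (cmod (c i))\<^sup>2)" using n by (intro mult_pos_pos) auto
      then have "Re (\<Sum>i\<in>{..n}. \<Sum>j\<in>{..n}. c i * cnj (c j) *
          (H p (v0 i) (v0 j) - of_real t * C p (v0 i) (v0 j))) < 0"
        using elim(2)[rule_format, of c] by linarith
      also have "(\<Sum>i\<in>{..n}. \<Sum>j\<in>{..n}. c i * cnj (c j) * (H p (v0 i) (v0 j) - of_real t * C p (v0 i) (v0 j))) =
          H p (lin_comb {..n} c v0) (lin_comb {..n} c v0) - of_real t * C p (lin_comb {..n} c v0) (lin_comb {..n} c v0)"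
        unfolding hermitian_form_lin_comb_both[OF H] hermitian_form_lin_comb_both[OF C]
        by (simp add: right_diff_distrib sum_subtractf sum_distrib_left mult_ac)
      finally show "Re (H p (lin_comb {..n} c v0) (lin_comb {..n} c v0)) <
          t * Re (C p (lin_comb {..n} c v0) (lin_comb {..n} c v0))" by simp
    qed auto
  qed
qed

definition add_penalty where
  "add_penalty a s G x y = G x y + complex_of_real s * (x a * cnj (y a))"

lemma hermitian_form_add_penalty:
  assumes "hermitian_form G" shows "hermitian_form (add_penalty a s G)"
proof -
  have "hermitian_form (\<lambda>x y. x a * cnj (y a))"
    by (rule hermitian_formI) (simp_all add: algebra_simps)
  from hermitian_form_add_scaleR[OF assms this] show ?thesis by (simp add: add_penalty_def [abs_def])
qed

text \<open>Adding \<open>unit_vec a\<close> to the first \<open>n\<close> limit eigenvectors gives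
  a test space of dimension \<open>n + 1\<close>. Hence \<open>l p n\<close> is controlled by
  \<open>l0\<close> below \<open>n\<close>: the indices shift by one because an eigenvalue escapes
  at the bottom. For \<open>n = 0\<close> the bound \<open>t\<close> is arbitrary, which is the
  escape to minus infinity.\<close>

lemma diagonalized_less_eventually_singular:
  fixes G C :: "'p \<Rightarrow> (nat \<Rightarrow> complex) \<Rightarrow> (nat \<Rightarrow> complex) \<Rightarrow> complex" and s :: "'p \<Rightarrow> real"
  assumes G: "\<And>p. hermitian_form (G p)" and C: "\<And>p. hermitian_form (C p)"
    and J: "finite J0" "a \<notin> J0"
    and d0: "diagonalized J0 B0 C0 v0 l0"
    and d: "\<forall>\<^sub>F p in F. \<exists>v. diagonalized (insert a J0) (add_penalty a (s p) (G p)) (C p) v (l p)"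
    and limG: "\<And>x y. x \<in> supported (insert a J0) \<Longrightarrow> y \<in> supported (insert a J0) \<Longrightarrow> ((\<lambda>p. G p x y) \<longlongrightarrow> B0 x y) F"
    and limC: "\<And>x y. x \<in> supported (insert a J0) \<Longrightarrow> y \<in> supported (insert a J0) \<Longrightarrow> ((\<lambda>p. C p x y) \<longlongrightarrow> C0 x y) F"
    and s: "filterlim s at_bot F"
    and n: "n \<le> card J0" "\<And>i. i < n \<Longrightarrow> l0 i < t"
  shows "\<forall>\<^sub>F p in F. l p n < t"
proof -
  \<comment> \<open>Only \<open>v0 i\<close> with \<open>i < n\<close> are used, so slot
    \<open>n\<close> is free for the penalised direction.\<close>
  define u where "u = v0(n := unit_vec a)"
  define I where "I = insert n {..<n}"
  have v0: "v0 i \<in> supported J0" if "i < n" for i using d0 n that by (simp add: diagonalized_def)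
  have u: "u i \<in> supported (insert a J0)" if "i \<in> I" for i
    using v0[of i] that by (auto simp: u_def I_def supported_def unit_vec_def)
  have nJ: "n < card (insert a J0)" using n J by simp
  have mono0: "l0 i \<le> l0 j" if "i \<le> j" "j < card J0" for i j
    using d0 that by (simp add: diagonalized_def)
  \<comment> \<open>By monotonicity \<open>l0 (n - 1)\<close> is the value closest to
    \<open>t\<close>. For \<open>n = 0\<close> there is nothing to bound and any positive number
    will do.\<close>
  define \<delta> where "\<delta> = (if n = 0 then 1 else t - l0 (n - 1))"
  have \<delta>: "\<delta> > 0" "l0 i - t \<le> - \<delta>" if "i < n" for i
  proof -
    show "\<delta> > 0" using n by (auto simp: \<delta>_def)
    have "l0 i \<le> l0 (n - 1)" using mono0[of i "n - 1"] that n by simp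
    then show "l0 i - t \<le> - \<delta>" using that by (simp add: \<delta>_def)
  qed
  have \<delta>0: "\<delta> > 0" using n by (auto simp: \<delta>_def)
  have lim_a: "((\<lambda>p. G p (u i) (u j) - of_real t * C p (u i) (u j)) \<longlongrightarrow>
        B0 (u i) (u j) - of_real t * C0 (u i) (u j)) F" if "i \<in> I" "j \<in> I" for i j
    using that by (intro tendsto_intros limG limC u) auto
  have lim: "((\<lambda>p. G p (u i) (u j) - of_real t * C p (u i) (u j)) \<longlongrightarrow>
      (if i = j then of_real (l0 i - t) else 0)) F" if "i \<in> {..<n}" "j \<in> {..<n}" for i j
  proof -
    have "B0 (u i) (u j) - of_real t * C0 (u i) (u j) = (if i = j then of_real (l0 i - t) else 0)"
      using d0 n that v0 by (simp add: diagonalized_def u_def)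
    with lim_a[of i j] that show ?thesis by (simp add: I_def)
  qed
  have "\<forall>\<^sub>F p in F. \<forall>c. (\<exists>i\<in>I. c i \<noteq> 0) \<longrightarrow> Re (\<Sum>i\<in>I. \<Sum>j\<in>I. c i * cnj (c j) *
      (G p (u i) (u j) - of_real t * C p (u i) (u j))) + s p * (cmod (c n))\<^sup>2 < 0"
    unfolding I_def
    by (rule eventually_form_negative_singular[where m="\<lambda>i. l0 i - t" and \<delta>=\<delta>,
          OF _ _ \<delta>0 _ lim lim_a s]) (use \<delta>(2) in \<open>auto simp: I_def\<close>)
  with d show ?thesis
  proof eventually_elim
    case (elim p)
    then obtain v where v: "diagonalized (insert a J0) (add_penalty a (s p) (G p)) (C p) v (l p)" by auto
    show ?case
    proof (rule eigenvalue_less_test[OF hermitian_form_add_penalty[OF G] C v nJ, of I u])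
      fix c :: "nat \<Rightarrow> complex" assume c: "\<exists>i\<in>I. c i \<noteq> 0"
      define y where "y = lin_comb I c u"
      \<comment> \<open>The \<open>v0 i\<close> vanish at \<open>a\<close>, so the penalty sees only
        the coefficient of \<open>unit_vec a\<close>.\<close>
      have ya: "y a = c n"
      proof -
        have "v0 i a = 0" if "i < n" for i using v0[OF that] J by (simp add: supported_def)
        then show ?thesis by (simp add: y_def lin_comb_def I_def u_def unit_vec_def)
      qed
      have "(\<Sum>i\<in>I. \<Sum>j\<in>I. c i * cnj (c j) * (G p (u i) (u j) - of_real t * C p (u i) (u j))) =
          G p y y - of_real t * C p y y"
        unfolding y_def hermitian_form_lin_comb_both[OF G] hermitian_form_lin_comb_both[OF C]
        by (simp add: right_diff_distrib sum_subtractf sum_distrib_left mult_ac)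
      moreover have "Re (add_penalty a (s p) (G p) y y) = Re (G p y y) + s p * (cmod (c n))\<^sup>2"
        by (simp add: add_penalty_def ya flip: complex_norm_square of_real_power)
      ultimately have "Re (add_penalty a (s p) (G p) y y) < t * Re (C p y y)"
        using elim(2)[rule_format, OF c] by simp
      then show "Re (add_penalty a (s p) (G p) (lin_comb I c u) (lin_comb I c u)) <
          t * Re (C p (lin_comb I c u) (lin_comb I c u))" by (simp add: y_def)
    qed (use u in \<open>auto simp: I_def\<close>)
  qed
qed

section \<open>Lower bounds by negation, and limits of eigenvalues\<close>

lemma eventually_diagonalized_uminus:
  assumes "\<forall>\<^sub>F p in F. \<exists>v. diagonalized J (H p) (C p) v (l p)"
  shows "\<forall>\<^sub>F p in F. \<exists>v. diagonalized J (\<lambda>x y. - H p x y) (C p) v (\<lambda>i. - l p (card J - Suc i))"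
  using assms by eventually_elim (blast intro: diagonalized_uminus)

lemma hermitian_form_uminus: "hermitian_form B \<Longrightarrow> hermitian_form (\<lambda>x y. - B x y)"
  using hermitian_form_add_scaleR[of B B "-2"] by simp

lemma add_penalty_uminus: "(\<lambda>x y. - add_penalty a s G x y) = add_penalty a (- s) (\<lambda>x y. - G x y)"
  by (simp add: add_penalty_def fun_eq_iff)

text \<open>This is the upper bound for the negated forms. The limit and the perturbed pencil must
  share the index set \<open>J\<close>, since the reversal of indices counts down from
  \<open>card J\<close> in both.\<close>

lemma diagonalized_greater_eventually:
  fixes H C :: "'p \<Rightarrow> (nat \<Rightarrow> complex) \<Rightarrow> (nat \<Rightarrow> complex) \<Rightarrow> complex"
  assumes H: "\<And>p. hermitian_form (H p)" and C: "\<And>p. hermitian_form (C p)" and J: "finite J"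
    and d0: "diagonalized J B0 C0 v0 l0"
    and d: "\<forall>\<^sub>F p in F. \<exists>v. diagonalized J (H p) (C p) v (l p)"
    and limH: "\<And>x y. x \<in> supported J \<Longrightarrow> y \<in> supported J \<Longrightarrow> ((\<lambda>p. H p x y) \<longlongrightarrow> B0 x y) F"
    and limC: "\<And>x y. x \<in> supported J \<Longrightarrow> y \<in> supported J \<Longrightarrow> ((\<lambda>p. C p x y) \<longlongrightarrow> C0 x y) F"
    and n: "n < card J" "t < l0 n"
  shows "\<forall>\<^sub>F p in F. t < l p n"
proof -
  have "\<forall>\<^sub>F p in F. - l p (card J - Suc (card J - Suc n)) < - t"
    by (rule diagonalized_less_eventually[OF hermitian_form_uminus[OF H] C J order_refl
          diagonalized_uminus[OF d0] eventually_diagonalized_uminus[OF d] tendsto_minus[OF limH] limC])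
       (use n in auto)
  then show ?thesis using n by (simp add: Suc_diff_Suc)
qed

theorem diagonalized_tendsto:
  fixes H C :: "'p \<Rightarrow> (nat \<Rightarrow> complex) \<Rightarrow> (nat \<Rightarrow> complex) \<Rightarrow> complex"
  assumes "\<And>p. hermitian_form (H p)" "\<And>p. hermitian_form (C p)" "finite J"
    and "diagonalized J B0 C0 v0 l0"
    and "\<forall>\<^sub>F p in F. \<exists>v. diagonalized J (H p) (C p) v (l p)"
    and "\<And>x y. x \<in> supported J \<Longrightarrow> y \<in> supported J \<Longrightarrow> ((\<lambda>p. H p x y) \<longlongrightarrow> B0 x y) F"
    and "\<And>x y. x \<in> supported J \<Longrightarrow> y \<in> supported J \<Longrightarrow> ((\<lambda>p. C p x y) \<longlongrightarrow> C0 x y) F"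
    and "n < card J"
  shows "((\<lambda>p. l p n) \<longlongrightarrow> l0 n) F"
proof (rule order_tendstoI)
  show "\<forall>\<^sub>F p in F. t < l p n" if "t < l0 n" for t
    by (rule diagonalized_greater_eventually[where H=H and C=C]) (use assms that in auto)
  show "\<forall>\<^sub>F p in F. l p n < t" if "l0 n < t" for t
    by (rule diagonalized_less_eventually[where H=H and C=C and J=J]) (use assms that in auto)
qed

text \<open>The singular upper bound is applied to the negated forms. Reversal counts from
  \<open>card J0\<close> for the limit but from one more for the perturbed pencil, which cancels the
  shift of indices. For \<open>n = card J0\<close> there is no condition on \<open>t\<close>, so the
  top eigenvalue exceeds every bound.\<close>

lemma diagonalized_penalty_greater_eventually:
  fixes G C :: "'p \<Rightarrow> (nat \<Rightarrow> complex) \<Rightarrow> (nat \<Rightarrow> complex) \<Rightarrow> complex" and s :: "'p \<Rightarrow> real"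
  assumes G: "\<And>p. hermitian_form (G p)" and C: "\<And>p. hermitian_form (C p)"
    and J: "finite J0" "a \<notin> J0"
    and d0: "diagonalized J0 B0 C0 v0 l0"
    and d: "\<forall>\<^sub>F p in F. \<exists>v. diagonalized (insert a J0) (add_penalty a (s p) (G p)) (C p) v (l p)"
    and limG: "\<And>x y. x \<in> supported (insert a J0) \<Longrightarrow> y \<in> supported (insert a J0) \<Longrightarrow> ((\<lambda>p. G p x y) \<longlongrightarrow> B0 x y) F"
    and limC: "\<And>x y. x \<in> supported (insert a J0) \<Longrightarrow> y \<in> supported (insert a J0) \<Longrightarrow> ((\<lambda>p. C p x y) \<longlongrightarrow> C0 x y) F"
    and s: "filterlim s at_top F"
    and n: "n \<le> card J0" "n < card J0 \<Longrightarrow> t < l0 n"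
  shows "\<forall>\<^sub>F p in F. t < l p n"
proof -
  have mono: "l0 n \<le> l0 j" if "n \<le> j" "j < card J0" for j
    using d0 that by (simp add: diagonalized_def)
  have "\<forall>\<^sub>F p in F. - l p (card (insert a J0) - Suc (card J0 - n)) < - t"
  proof (rule diagonalized_less_eventually_singular[where n="card J0 - n"
          and l="\<lambda>p i. - l p (card (insert a J0) - Suc i)" and s="\<lambda>p. - s p", OF hermitian_form_uminus[OF G] C J
          diagonalized_uminus[OF d0] _ tendsto_minus[OF limG] limC])
    show "\<forall>\<^sub>F p in F. \<exists>v. diagonalized (insert a J0) (add_penalty a (- s p) (\<lambda>x y. - G p x y)) (C p) v
        (\<lambda>i. - l p (card (insert a J0) - Suc i))"
      using eventually_diagonalized_uminus[OF d] by (simp only: add_penalty_uminus)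
    show "LIM p F. - s p :> at_bot" using s by (simp add: filterlim_uminus_at_bot)
    show "- l0 (card J0 - Suc i) < - t" if "i < card J0 - n" for i
      using mono[of "card J0 - Suc i"] n(2) that by force
  qed auto
  moreover have "card (insert a J0) - Suc (card J0 - n) = n" using n J by simp
  ultimately show ?thesis by simp
qed

text \<open>Lower bounds come from the growing penalty. Upper bounds come from test vectors
  supported in \<open>J0\<close>, on which the penalty is zero whatever the size of
  \<open>s p\<close>.\<close>

theorem diagonalized_penalty_at_top:
  fixes G C :: "'p \<Rightarrow> (nat \<Rightarrow> complex) \<Rightarrow> (nat \<Rightarrow> complex) \<Rightarrow> complex" and s :: "'p \<Rightarrow> real"
  assumes G: "\<And>p. hermitian_form (G p)" and C: "\<And>p. hermitian_form (C p)"
    and J: "finite J0" "a \<notin> J0"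
    and d0: "diagonalized J0 B0 C0 v0 l0"
    and d: "\<forall>\<^sub>F p in F. \<exists>v. diagonalized (insert a J0) (add_penalty a (s p) (G p)) (C p) v (l p)"
    and limG: "\<And>x y. x \<in> supported (insert a J0) \<Longrightarrow> y \<in> supported (insert a J0) \<Longrightarrow> ((\<lambda>p. G p x y) \<longlongrightarrow> B0 x y) F"
    and limC: "\<And>x y. x \<in> supported (insert a J0) \<Longrightarrow> y \<in> supported (insert a J0) \<Longrightarrow> ((\<lambda>p. C p x y) \<longlongrightarrow> C0 x y) F"
    and s: "filterlim s at_top F"
  shows "n < card J0 \<Longrightarrow> ((\<lambda>p. l p n) \<longlongrightarrow> l0 n) F"
    and "filterlim (\<lambda>p. l p (card J0)) at_top F"
proof -
  note greater = diagonalized_penalty_greater_eventually[OF G C J d0 d limG limC s]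
  show "filterlim (\<lambda>p. l p (card J0)) at_top F"
    unfolding filterlim_at_top_dense using greater by auto
  assume n: "n < card J0"
  show "((\<lambda>p. l p n) \<longlongrightarrow> l0 n) F"
  proof (rule order_tendstoI)
    show "\<forall>\<^sub>F p in F. t < l p n" if "t < l0 n" for t by (rule greater) (use n that in auto)
    show "\<forall>\<^sub>F p in F. l p n < t" if "l0 n < t" for t
    proof (rule diagonalized_less_eventually[OF hermitian_form_add_penalty[OF G] C _ _ d0 d _ limC n that])
      fix x y assume xy: "x \<in> supported J0" "y \<in> supported J0"
      then have "x a = 0" using J by (simp add: supported_def)
      then show "((\<lambda>p. add_penalty a (s p) (G p) x y) \<longlongrightarrow> B0 x y) F"
        using limG[of x y] xy by (simp add: add_penalty_def supported_def)
    qed (use J in \<open>auto simp: supported_def\<close>)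
  qed
qed

text \<open>Negate \<open>G\<close> and \<open>s\<close>. The escaping eigenvalue now occupies index
  0, so the remaining ones appear with index \<open>Suc n\<close>.\<close>

corollary diagonalized_penalty_at_bot:
  fixes G C :: "'p \<Rightarrow> (nat \<Rightarrow> complex) \<Rightarrow> (nat \<Rightarrow> complex) \<Rightarrow> complex" and s :: "'p \<Rightarrow> real"
  assumes G: "\<And>p. hermitian_form (G p)" and C: "\<And>p. hermitian_form (C p)"
    and J: "finite J0" "a \<notin> J0"
    and d0: "diagonalized J0 B0 C0 v0 l0"
    and d: "\<forall>\<^sub>F p in F. \<exists>v. diagonalized (insert a J0) (add_penalty a (s p) (G p)) (C p) v (l p)"
    and limG: "\<And>x y. x \<in> supported (insert a J0) \<Longrightarrow> y \<in> supported (insert a J0) \<Longrightarrow> ((\<lambda>p. G p x y) \<longlongrightarrow> B0 x y) F"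
    and limC: "\<And>x y. x \<in> supported (insert a J0) \<Longrightarrow> y \<in> supported (insert a J0) \<Longrightarrow> ((\<lambda>p. C p x y) \<longlongrightarrow> C0 x y) F"
    and s: "filterlim s at_bot F"
  shows "n < card J0 \<Longrightarrow> ((\<lambda>p. l p (Suc n)) \<longlongrightarrow> l0 n) F"
    and "filterlim (\<lambda>p. l p 0) at_bot F"
proof -
  have d': "\<forall>\<^sub>F p in F. \<exists>v. diagonalized (insert a J0) (add_penalty a (- s p) (\<lambda>x y. - G p x y)) (C p) v
      (\<lambda>i. - l p (card (insert a J0) - Suc i))"
    using eventually_diagonalized_uminus[OF d] by (simp only: add_penalty_uminus)
  have s': "filterlim (\<lambda>p. - s p) at_top F" using s by (simp add: filterlim_uminus_at_bot)
  note top = diagonalized_penalty_at_top[OF hermitian_form_uminus[OF G] C J diagonalized_uminus[OF d0] d'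
      tendsto_minus[OF limG] limC s']
  show "filterlim (\<lambda>p. l p 0) at_bot F"
    using top(2) J by (simp add: filterlim_uminus_at_bot)
  assume n: "n < card J0"
  then have "((\<lambda>p. - l p (card (insert a J0) - Suc (card J0 - Suc n))) \<longlongrightarrow> - l0 (card J0 - Suc (card J0 - Suc n))) F"
    by (intro top(1)) auto
  moreover have "card (insert a J0) - Suc (card J0 - Suc n) = Suc n" "card J0 - Suc (card J0 - Suc n) = n"
    using n J by auto
  ultimately show "((\<lambda>p. l p (Suc n)) \<longlongrightarrow> l0 n) F" by (simp add: tendsto_minus_cancel_left)
qed

section \<open>The problem as a Hermitian pencil\<close>

text \<open>Recovers y_1, ..., y_N from the coordinates x of the overview.\<close>

definition shear :: "complex \<Rightarrow> nat \<Rightarrow> (nat \<Rightarrow> complex) \<Rightarrow> nat \<Rightarrow> complex" where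
  "shear z N x n = (if n = 1 then x 1 - cnj z * x N else x n)"

text \<open>Summation by parts over the interior edges only. The fluxes through the edges 0 and N
  are eliminated: the \<open>b\<close> term comes from the second boundary row, and the rest of both
  rows enters through \<open>shear\<close> and the penalty.\<close>

definition energy :: "nat \<Rightarrow> equation \<Rightarrow> real \<Rightarrow> (nat \<Rightarrow> complex) \<Rightarrow> (nat \<Rightarrow> complex) \<Rightarrow> complex" where
  "energy N \<omega> b x y =
     (\<Sum>n\<in>{1..<N}. of_real (f_of \<omega> n) * (x (Suc n) - x n) * cnj (y (Suc n) - y n))
     + (\<Sum>n\<in>{1..N}. of_real (q_of \<omega> n) * x n * cnj (y n)) + of_real b * x N * cnj (y N)"

definition weight :: "nat \<Rightarrow> equation \<Rightarrow> (nat \<Rightarrow> complex) \<Rightarrow> (nat \<Rightarrow> complex) \<Rightarrow> complex" where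
  "weight N \<omega> x y = (\<Sum>n\<in>{1..N}. of_real (w_of \<omega> n) * x n * cnj (y n))"

lemma hermitian_energy: "hermitian_form (energy N \<omega> b)"
proof (rule hermitian_formI)
  show "energy N \<omega> b (\<lambda>n. c * x n + x' n) y = c * energy N \<omega> b x y + energy N \<omega> b x' y" for c x x' y
    by (simp add: energy_def sum_distrib_left sum.distrib[symmetric] algebra_simps)
  show "energy N \<omega> b y x = cnj (energy N \<omega> b x y)" for x y
    by (simp add: energy_def mult_ac)
qed

lemma hermitian_weight: "hermitian_form (weight N \<omega>)"
  by (rule hermitian_formI) (simp_all add: weight_def sum_distrib_left sum.distrib[symmetric] algebra_simps)

lemma shear_comb: "shear z N (\<lambda>n. c * x n + x' n) = (\<lambda>n. c * shear z N x n + shear z N x' n)"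
  by (auto simp: shear_def algebra_simps)

lemma hermitian_form_shear:
  "hermitian_form B \<Longrightarrow> hermitian_form (\<lambda>x y. B (shear z N x) (shear z N y))"
  by (rule hermitian_formI) (simp_all only: shear_comb hermitian_form_comb, rule hermitian_form_cnj)

text \<open>The difference equation at \<open>n\<close> with the fluxes through the edges 0 and N
  cut off by the conditionals, and with \<open>b * y N\<close> in place of the flux at the right
  end.\<close>

definition residual :: "nat \<Rightarrow> equation \<Rightarrow> real \<Rightarrow> complex \<Rightarrow> (nat \<Rightarrow> complex) \<Rightarrow> nat \<Rightarrow> complex" where
  "residual N \<omega> b \<mu> y n =
     (if 2 \<le> n then of_real (f_of \<omega> (n - 1)) * (y n - y (n - 1)) else 0)
     - (if n < N then of_real (f_of \<omega> n) * (y (Suc n) - y n) else 0)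
     + of_real (q_of \<omega> n) * y n + (if n = N then of_real b * y N else 0) - \<mu> * of_real (w_of \<omega> n) * y n"

lemma residual_comb:
  "residual N \<omega> b \<mu> (\<lambda>n. c * x n + x' n) n = c * residual N \<omega> b \<mu> x n + residual N \<omega> b \<mu> x' n"
  by (simp add: residual_def algebra_simps)

lemma residual_eq_forms:
  assumes n: "n \<in> {1..N}"
  shows "residual N \<omega> b \<mu> y n = energy N \<omega> b y (unit_vec n) - \<mu> * weight N \<omega> y (unit_vec n)"
proof -
  \<comment> \<open>The unit vector at \<open>n\<close> meets the edges \<open>m\<close> and
    \<open>n\<close>. Edge \<open>m\<close> is outside the sum exactly when \<open>n = 1\<close>,
    and edge \<open>n\<close> exactly when \<open>n = N\<close>, as in the conditionals of
    \<open>residual\<close>.\<close>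
  obtain m where m: "n = Suc m" using n by (cases n) auto
  have "(\<Sum>k\<in>{1..<N}. of_real (f_of \<omega> k) * (y (Suc k) - y k) * cnj (unit_vec n (Suc k) - unit_vec n k))
      = (\<Sum>k\<in>{1..<N}. (if k = m then of_real (f_of \<omega> k) * (y (Suc k) - y k) else 0))
        - (\<Sum>k\<in>{1..<N}. (if k = n then of_real (f_of \<omega> k) * (y (Suc k) - y k) else 0))"
    unfolding sum_subtractf[symmetric] by (intro sum.cong) (auto simp: unit_vec_def m)
  moreover have "(\<Sum>k\<in>{1..N}. of_real (q_of \<omega> k) * y k * cnj (unit_vec n k))
      = (\<Sum>k\<in>{1..N}. if k = n then of_real (q_of \<omega> k) * y k else 0)"
    by (intro sum.cong) (auto simp: unit_vec_def)
  moreover have "(\<Sum>k\<in>{1..N}. of_real (w_of \<omega> k) * y k * cnj (unit_vec n k))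
      = (\<Sum>k\<in>{1..N}. if k = n then of_real (w_of \<omega> k) * y k else 0)"
    by (intro sum.cong) (auto simp: unit_vec_def)
  ultimately show ?thesis
    using n by (auto simp: energy_def weight_def residual_def unit_vec_def m)
qed

text \<open>The parameter \<open>b\<close> is no part of the equation: the right side at
  \<open>N\<close> cancels the \<open>b\<close> term of \<open>residual\<close>. It is kept so that
  the second boundary row can be substituted directly.\<close>

lemma solves_eq_residual:
  assumes "N \<ge> 2"
  shows "solves_eq N \<omega> \<mu> y \<longleftrightarrow>
     residual N \<omega> b \<mu> y 1 + of_real (f_of \<omega> 0) * (y 1 - y 0) = 0 \<and>
     (\<forall>n\<in>{2..<N}. residual N \<omega> b \<mu> y n = 0) \<and>
     residual N \<omega> b \<mu> y N = of_real b * y N + of_real (f_of \<omega> N) * (y (Suc N) - y N)"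
proof -
  define E where "E n \<longleftrightarrow> - bdiff (\<lambda>k. of_real (f_of \<omega> k) * fdiff y k) n + of_real (q_of \<omega> n) * y n
      = \<mu> * of_real (w_of \<omega> n) * y n" for n
  have N: "{1..N} = insert 1 (insert N {2..<N})" using assms by auto
  have "solves_eq N \<omega> \<mu> y \<longleftrightarrow> (\<forall>n\<in>insert 1 (insert N {2..<N}). E n)"
    unfolding solves_eq_def E_def N ..
  moreover have "E 1 \<longleftrightarrow> residual N \<omega> b \<mu> y 1 + of_real (f_of \<omega> 0) * (y 1 - y 0) = 0"
    using assms by (auto simp: E_def residual_def bdiff_def fdiff_def algebra_simps)
  moreover have "E n \<longleftrightarrow> residual N \<omega> b \<mu> y n = 0" if "n \<in> {2..<N}" for n
    using that by (auto simp: E_def residual_def bdiff_def fdiff_def algebra_simps)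
  moreover have "E N \<longleftrightarrow> residual N \<omega> b \<mu> y N = of_real b * y N + of_real (f_of \<omega> N) * (y (Suc N) - y N)"
    using assms by (auto simp: E_def residual_def bdiff_def fdiff_def algebra_simps)
  ultimately show ?thesis by auto
qed

section \<open>Boundary conditions of a class and of its normal form\<close>

lemma satisfies_bc_mult:
  assumes "invertible G"
  shows "satisfies_bc N \<omega> (G ** M) y \<longleftrightarrow> satisfies_bc N \<omega> M y"
proof -
  have l: "left_block (G ** M) = G ** left_block M" and r: "right_block (G ** M) = G ** right_block M"
    by (simp_all add: left_block_def right_block_def matrix_matrix_mult_def vec_eq_iff forall_2)
  have inj: "G *v v = 0 \<longleftrightarrow> v = 0" for v :: "complex^2"
    using assms by (metis invertible_def matrix_vector_mul_assoc matrix_vector_mul_lid matrix_vector_mult_0_right)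
  show ?thesis
    unfolding satisfies_bc_def l r matrix_vector_mul_assoc[symmetric] matrix_vector_right_distrib[symmetric]
    by (rule inj)
qed

lemma invertible_mat_1: "invertible (mat 1 :: complex^2^2)"
  unfolding invertible_def by (metis matrix_mul_lid)

lemma GL_class_self: "M \<in> GL_class M"
  unfolding GL_class_def using invertible_mat_1 by (metis (mono_tags, lifting) mem_Collect_eq matrix_mul_lid)

lemma satisfies_bc_class:
  "(\<forall>M'\<in>GL_class M. satisfies_bc N \<omega> M' y) \<longleftrightarrow> satisfies_bc N \<omega> M y"
  using GL_class_self[of M] by (auto simp: GL_class_def satisfies_bc_mult)

lemma satisfies_bc_normal_14:
  "satisfies_bc N \<omega> (normal_14 a z b) y \<longleftrightarrow>
     y 0 + of_real a * (of_real (f_of \<omega> 0) * (y 1 - y 0)) + cnj z * y N = 0 \<and>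
     z * (of_real (f_of \<omega> 0) * (y 1 - y 0)) + of_real b * y N + of_real (f_of \<omega> N) * (y (Suc N) - y N) = 0"
  by (auto simp: satisfies_bc_def left_block_def right_block_def normal_14_def fdiff_def
      vec_eq_iff forall_2 matrix_vector_mult_def sum_2 add_ac)

definition sheared_energy where
  "sheared_energy N \<omega> z b x y = energy N \<omega> b (shear z N x) (shear z N y)"

definition sheared_weight where
  "sheared_weight N \<omega> z x y = weight N \<omega> (shear z N x) (shear z N y)"

text \<open>If \<open>a = 1 / f\<^sub>0\<close>, division by zero switches the penalty off; the constraint that replaces it,
  \<open>x\<^sub>1 = 0\<close>, is encoded by dropping the index 1 from \<open>active\<close>.\<close>

definition pencil_form where
  "pencil_form N \<omega> a z b = add_penalty 1 (1 / (1 / f_of \<omega> 0 - a)) (sheared_energy N \<omega> z b)"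

definition active :: "nat \<Rightarrow> equation \<Rightarrow> real \<Rightarrow> nat set" where
  "active N \<omega> a = (if a = 1 / f_of \<omega> 0 then {2..N} else {1..N})"

lemma hermitian_sheared_energy: "hermitian_form (sheared_energy N \<omega> z b)"
  using hermitian_form_shear[OF hermitian_energy] by (simp add: sheared_energy_def [abs_def])

lemma hermitian_sheared_weight: "hermitian_form (sheared_weight N \<omega> z)"
  using hermitian_form_shear[OF hermitian_weight] by (simp add: sheared_weight_def [abs_def])

lemma hermitian_pencil_form: "hermitian_form (pencil_form N \<omega> a z b)"
  unfolding pencil_form_def by (rule hermitian_form_add_penalty[OF hermitian_sheared_energy])

lemma Omega_f_nonzero: "\<omega> \<in> Omega N \<Longrightarrow> n \<le> N \<Longrightarrow> f_of \<omega> n \<noteq> 0"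
  by (auto simp: Omega_def f_of_def)

lemma Omega_w_pos: "\<omega> \<in> Omega N \<Longrightarrow> n \<in> {1..N} \<Longrightarrow> w_of \<omega> n > 0"
  by (auto simp: Omega_def w_of_def)

lemma active_subset: "active N \<omega> a \<subseteq> {1..N}"
  by (auto simp: active_def)

lemma sheared_weight_pos:
  assumes "N \<ge> 2" "\<omega> \<in> Omega N" "x \<in> supported {1..N}" "x \<noteq> (\<lambda>_. 0)"
  shows "0 < Re (sheared_weight N \<omega> z x x)"
proof -
  have "\<exists>n\<in>{1..N}. shear z N x n \<noteq> 0"
  proof (rule ccontr)
    assume "\<not> ?thesis"
    then have *: "shear z N x n = 0" if "n \<in> {1..N}" for n using that by blast
    have "x n = 0" for n
      using assms(1,3) *[of n] *[of N] *[of 1]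
      by (cases "n \<in> {1..N}") (auto simp: shear_def supported_def split: if_splits)
    then show False using assms(4) by auto
  qed
  then obtain n where n: "n \<in> {1..N}" "shear z N x n \<noteq> 0" by auto
  have "Re (of_real (w_of \<omega> k) * c * cnj c) = w_of \<omega> k * (cmod c)\<^sup>2" for k c
    unfolding cmod_power2 by (simp add: power2_eq_square algebra_simps)
  then have "Re (sheared_weight N \<omega> z x x) = (\<Sum>k\<in>{1..N}. w_of \<omega> k * (cmod (shear z N x k))\<^sup>2)"
    by (simp only: sheared_weight_def weight_def Re_sum)
  also have "\<dots> > 0"
  proof (rule sum_pos2[OF _ n(1)])
    show "0 < w_of \<omega> n * (cmod (shear z N x n))\<^sup>2" using n Omega_w_pos[OF assms(2)] by simp
    show "0 \<le> w_of \<omega> k * (cmod (shear z N x k))\<^sup>2" if "k \<in> {1..N}" for k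
      using Omega_w_pos[OF assms(2) that] by simp
  qed simp
  finally show ?thesis .
qed

lemma shear_unit_vec:
  assumes "N \<ge> 2"
  shows "n < N \<Longrightarrow> shear z N (unit_vec n) = unit_vec n"
    and "shear z N (unit_vec N) = (\<lambda>k. - cnj z * unit_vec 1 k + unit_vec N k)"
  using assms by (auto simp: shear_def unit_vec_def fun_eq_iff)

text \<open>It suffices to test against unit vectors. Shearing the one at \<open>N\<close> produces
  \<open>- cnj z\<close> times the one at 1, and since forms are antilinear in the second argument
  this row becomes \<open>r N = z * r 1\<close>. The row at 1 is stated after multiplication by
  \<epsilon>, so that it also covers \<epsilon> = 0: then it says \<open>x 1 = 0\<close>, already
  ensured by the support, and leaves \<open>r 1\<close> free.\<close>

lemma weak_eigenvector_iff:
  fixes a b :: real and z \<mu> :: complex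
  assumes N: "N \<ge> 2" and x: "x \<in> supported (active N \<omega> a)"
  defines "r \<equiv> residual N \<omega> b \<mu> (shear z N x)"
  shows "(\<forall>v\<in>supported (active N \<omega> a). pencil_form N \<omega> a z b x v = \<mu> * sheared_weight N \<omega> z x v) \<longleftrightarrow>
     of_real (1 / f_of \<omega> 0 - a) * r 1 + x 1 = 0 \<and> (\<forall>n\<in>{2..<N}. r n = 0) \<and> r N = z * r 1"
proof -
  define J where "J = active N \<omega> a"
  have J: "finite J" "J \<subseteq> {1..N}" by (auto simp: J_def active_def)
  define D where "D v = pencil_form N \<omega> a z b x v - \<mu> * sheared_weight N \<omega> z x v" for v
  have D_sum: "D v = (\<Sum>n\<in>J. cnj (v n) * D (unit_vec n))" if v: "v \<in> supported J" for v
    using hermitian_form_lin_comb_right[OF hermitian_pencil_form, of N \<omega> a z b x J v unit_vec]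
      hermitian_form_lin_comb_right[OF hermitian_sheared_weight, of N \<omega> z x J v unit_vec]
    by (simp add: lin_comb_unit_vec[OF J(1) v] D_def right_diff_distrib sum_subtractf sum_distrib_left mult_ac)
  have unit: "unit_vec n \<in> supported J" if "n \<in> J" for n
    using that by (auto simp: unit_vec_def supported_def)
  have "(\<forall>v\<in>supported J. D v = 0) \<longleftrightarrow> (\<forall>n\<in>J. D (unit_vec n) = 0)"
  proof
    assume "\<forall>n\<in>J. D (unit_vec n) = 0"
    then show "\<forall>v\<in>supported J. D v = 0" using D_sum by simp
  qed (use unit in blast)
  also have "\<dots> \<longleftrightarrow> (1 \<in> J \<longrightarrow> D (unit_vec 1) = 0) \<and> (\<forall>n\<in>{2..<N}. D (unit_vec n) = 0) \<and> D (unit_vec N) = 0"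
  proof -
    have "J = (if 1 \<in> J then {1} else {}) \<union> insert N {2..<N}"
      using N by (auto simp: J_def active_def)
    then show ?thesis by (smt (verit) Un_iff insert_iff empty_iff)
  qed
  also have "D (unit_vec 1) = r 1 + of_real (1 / (1 / f_of \<omega> 0 - a)) * x 1"
    using N shear_unit_vec(1)[OF N, of 1]
    by (simp add: D_def pencil_form_def add_penalty_def sheared_energy_def sheared_weight_def
        r_def residual_eq_forms) (simp add: unit_vec_def)
  also have "(\<forall>n\<in>{2..<N}. D (unit_vec n) = 0) \<longleftrightarrow> (\<forall>n\<in>{2..<N}. r n = 0)"
  proof (rule ball_cong[OF refl])
    fix n assume n: "n \<in> {2..<N}"
    then have "D (unit_vec n) = r n"
      using shear_unit_vec(1)[OF N, of n]
      by (simp add: D_def pencil_form_def add_penalty_def sheared_energy_def sheared_weight_def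
          r_def residual_eq_forms) (simp add: unit_vec_def)
    then show "D (unit_vec n) = 0 \<longleftrightarrow> r n = 0" by simp
  qed
  also have "D (unit_vec N) = r N - z * r 1"
  proof -
    have "energy N \<omega> b s (shear z N (unit_vec N)) = - z * energy N \<omega> b s (unit_vec 1) + energy N \<omega> b s (unit_vec N)"
      and "weight N \<omega> s (shear z N (unit_vec N)) = - z * weight N \<omega> s (unit_vec 1) + weight N \<omega> s (unit_vec N)" for s
      unfolding shear_unit_vec(2)[OF N] hermitian_form_comb_right[OF hermitian_energy]
        hermitian_form_comb_right[OF hermitian_weight] by simp_all
    moreover have "unit_vec N 1 = 0" using N by (simp add: unit_vec_def)
    moreover have "N \<in> {1..N}" "1 \<in> {1..N}" using N by auto
    ultimately show ?thesis
      by (simp only: D_def pencil_form_def add_penalty_def sheared_energy_def sheared_weight_def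
          r_def residual_eq_forms) (simp add: algebra_simps)
  qed
  also have "(1 \<in> J \<longrightarrow> r 1 + of_real (1 / (1 / f_of \<omega> 0 - a)) * x 1 = 0) \<longleftrightarrow>
      of_real (1 / f_of \<omega> 0 - a) * r 1 + x 1 = 0"
  proof (cases "a = 1 / f_of \<omega> 0")
    case True
    then show ?thesis using x by (simp add: J_def active_def supported_def)
  next
    case False
    define e where "e = complex_of_real (1 / f_of \<omega> 0 - a)"
    have e: "e \<noteq> 0" using False by (simp add: e_def del: of_real_diff)
    have "1 \<in> J" using False N by (simp add: J_def active_def)
    moreover have "complex_of_real (1 / (1 / f_of \<omega> 0 - a)) = 1 / e" by (simp add: e_def)
    moreover have "r 1 + 1 / e * x 1 = 0 \<longleftrightarrow> e * r 1 + x 1 = 0"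
      using e by (simp add: field_simps)
    ultimately show ?thesis by (simp only: e_def simp_thms)
  qed
  finally show ?thesis by (auto simp: D_def J_def)
qed

text \<open>The equation at 1 identifies \<open>r\<close> with minus the flux at 0. The two boundary
  rows can then be solved for the eliminated entries y_0 and y_(N+1).\<close>

definition extend :: "nat \<Rightarrow> equation \<Rightarrow> real \<Rightarrow> complex \<Rightarrow> real \<Rightarrow> complex \<Rightarrow> (nat \<Rightarrow> complex) \<Rightarrow> nat \<Rightarrow> complex" where
  "extend N \<omega> a z b \<mu> x n = (let y = shear z N x; r = residual N \<omega> b \<mu> y 1 in
     if n = 0 then of_real a * r - cnj z * y N
     else if n \<le> N then y n
     else if n = Suc N then y N + (z * r - of_real b * y N) / of_real (f_of \<omega> N)
     else 0)"

lemma residual_cong: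
  assumes "n \<in> {1..N}" "\<And>k. k \<in> {1..N} \<Longrightarrow> y k = y' k"
  shows "residual N \<omega> b \<mu> y n = residual N \<omega> b \<mu> y' n"
proof -
  have "y (n - 1) = y' (n - 1)" if "2 \<le> n" using assms(1) that by (intro assms(2)) auto
  moreover have "y n = y' n" "n < N \<Longrightarrow> y (Suc n) = y' (Suc n)" "y N = y' N"
    using assms(1) assms(2)[of n] assms(2)[of "Suc n"] assms(2)[of N] by auto
  ultimately show ?thesis by (simp add: residual_def)
qed

text \<open>Everything follows by substituting the flux at 0 by \<open>- r 1\<close>: the two
  boundary rows and the equations at 1 and N then split into the weak rows and the formulas in
  \<open>extend\<close>. No division by \<epsilon> occurs, so both index sets are treated at
  once.\<close>

lemma solutions_eq_extend:
  assumes N: "N \<ge> 2" and \<omega>: "\<omega> \<in> Omega N"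
  shows "solutions N (\<omega>, GL_class (normal_14 a z b)) \<mu> =
    extend N \<omega> a z b \<mu> ` {x \<in> supported (active N \<omega> a).
      \<forall>v\<in>supported (active N \<omega> a). pencil_form N \<omega> a z b x v = \<mu> * sheared_weight N \<omega> z x v}"
    (is "?S = _ ` ?E")
proof (intro subset_antisym subsetI)
  have f0: "complex_of_real (f_of \<omega> 0) \<noteq> 0" and fN: "complex_of_real (f_of \<omega> N) \<noteq> 0"
    using Omega_f_nonzero[OF \<omega>] by auto
  {
    fix y assume y: "y \<in> ?S"
    define x where "x = (\<lambda>n. if n = 1 then y 1 + cnj z * y N else if n \<in> {1..N} then y n else 0)"
    define r where "r = residual N \<omega> b \<mu> y"
    have sh: "shear z N x n = y n" if "n \<in> {1..N}" for n using that N by (simp add: x_def shear_def)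
    have r: "residual N \<omega> b \<mu> (shear z N x) n = r n" if "n \<in> {1..N}" for n
      unfolding r_def by (rule residual_cong) (use that sh in auto)
    have eqs: "r 1 + of_real (f_of \<omega> 0) * (y 1 - y 0) = 0" "\<forall>n\<in>{2..<N}. r n = 0"
      "r N = of_real b * y N + of_real (f_of \<omega> N) * (y (Suc N) - y N)"
      "y 0 + of_real a * (of_real (f_of \<omega> 0) * (y 1 - y 0)) + cnj z * y N = 0"
      "z * (of_real (f_of \<omega> 0) * (y 1 - y 0)) + of_real b * y N + of_real (f_of \<omega> N) * (y (Suc N) - y N) = 0"
      and y_out: "\<forall>n>N + 1. y n = 0"
      using y by (auto simp: solutions_def satisfies_bc_class satisfies_bc_normal_14
            solves_eq_residual[OF N, of _ _ _ b] r_def)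
    have u: "of_real (f_of \<omega> 0) * (y 1 - y 0) = - r 1" using eqs(1) by (simp add: add_eq_0_iff)
    have y0: "y 0 = of_real a * r 1 - cnj z * y N" using eqs(4) unfolding u by (simp add: algebra_simps)
    have t: "of_real (f_of \<omega> N) * (y (Suc N) - y N) = z * r 1 - of_real b * y N"
      using eqs(5) unfolding u by (simp add: algebra_simps)
    have y1: "y 1 = y 0 - r 1 / of_real (f_of \<omega> 0)" using u f0 by (simp add: field_simps)
    have x1: "of_real (1 / f_of \<omega> 0 - a) * r 1 + x 1 = 0"
      using y1 y0 by (simp add: x_def algebra_simps)
    \<comment> \<open>If \<open>a = 1 / f_0\<close>, then \<open>x1\<close> itself forces
      \<open>x 1 = 0\<close>, which puts \<open>x\<close> into the smaller index set.\<close>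
    have xs: "x \<in> supported (active N \<omega> a)"
      using x1 N by (auto simp: supported_def active_def x_def)
    have "x \<in> ?E"
      using xs x1 eqs(2,3) t r N by (simp add: weak_eigenvector_iff[OF N xs])
    moreover have "y = extend N \<omega> a z b \<mu> x"
    proof
      fix n
      have "y (Suc N) = y N + (z * r 1 - of_real b * y N) / of_real (f_of \<omega> N)"
        using t fN by (simp add: field_simps)
      then show "y n = extend N \<omega> a z b \<mu> x n"
        using N y0 y_out sh r by (auto simp: extend_def Let_def not_le)
    qed
    ultimately show "y \<in> extend N \<omega> a z b \<mu> ` ?E" by blast
  next
    fix y assume "y \<in> extend N \<omega> a z b \<mu> ` ?E"
    then obtain x where x: "x \<in> ?E" and y: "y = extend N \<omega> a z b \<mu> x" by blast
    have xs: "x \<in> supported (active N \<omega> a)" using x by simp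
    define s where "s = shear z N x"
    define r where "r = residual N \<omega> b \<mu> s"
    have E: "of_real (1 / f_of \<omega> 0 - a) * r 1 + x 1 = 0" "\<forall>n\<in>{2..<N}. r n = 0" "r N = z * r 1"
      using x unfolding mem_Collect_eq weak_eigenvector_iff[OF N xs] by (auto simp: r_def s_def)
    have ys: "y n = s n" if "n \<in> {1..N}" for n using that by (simp add: y extend_def s_def Let_def)
    have r: "residual N \<omega> b \<mu> y n = r n" if "n \<in> {1..N}" for n
      unfolding r_def by (rule residual_cong) (use that ys in auto)
    have y0: "y 0 = of_real a * r 1 - cnj z * s N" by (simp add: y extend_def r_def s_def Let_def)
    have yN: "y N = s N" and y1: "y 1 = x 1 - cnj z * s N"
      using ys[of N] ys[of 1] N by (auto simp: s_def shear_def)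
    have u: "of_real (f_of \<omega> 0) * (y 1 - y 0) = - r 1"
    proof -
      have "y 1 - y 0 = - (r 1 / of_real (f_of \<omega> 0))"
        using E(1) unfolding y1 y0 by (simp add: algebra_simps add_eq_0_iff)
      then show ?thesis using f0 by simp
    qed
    have t: "of_real (f_of \<omega> N) * (y (Suc N) - y N) = z * r 1 - of_real b * y N"
      using fN unfolding yN by (simp add: y extend_def r_def s_def Let_def)
    show "y \<in> ?S"
      unfolding solutions_def mem_Collect_eq fst_conv snd_conv satisfies_bc_class satisfies_bc_normal_14
        solves_eq_residual[OF N, of _ _ _ b] u t
      using E(2,3) r N y0 yN by (auto simp: y extend_def Let_def)
  }
qed

section \<open>Multiplicities and the spectrum\<close>

lemma sum_fun_apply: "(\<Sum>i\<in>I. g i) (n :: 'a) = (\<Sum>i\<in>I. g i n :: 'b :: comm_monoid_add)"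
  by (induction I rule: infinite_finite_induct) auto

text \<open>\<open>cseq.dim\<close> is about sets of vectors, so the family must first be shown
  injective: two equal members would satisfy the relation with coefficients 1 and -1.\<close>

lemma dim_lin_comb:
  assumes I: "finite I" and indep: "\<And>c. lin_comb I c V = (\<lambda>_. 0) \<Longrightarrow> \<forall>i\<in>I. c i = 0"
  shows "cseq.dim (range (\<lambda>c. lin_comb I c V)) = card I"
proof -
  have inj: "inj_on V I"
  proof (rule inj_onI)
    fix i j assume ij: "i \<in> I" "j \<in> I" "V i = V j"
    show "i = j"
    proof (rule ccontr)
      assume "i \<noteq> j"
      define c where "c k = (if k = i then 1 else if k = j then - 1 else 0 :: complex)" for k
      have "(\<Sum>k\<in>I. c k * V k n) = (\<Sum>k\<in>I. (if k = i then V i n else 0) - (if k = j then V i n else 0))" for n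
        using ij \<open>i \<noteq> j\<close> by (intro sum.cong) (auto simp: c_def)
      then have "lin_comb I c V = (\<lambda>_. 0)"
        using ij I by (auto simp: lin_comb_def fun_eq_iff sum_subtractf)
      then have "c i = 0" using indep ij by blast
      then show False by (simp add: c_def)
    qed
  qed
  have lin: "lin_comb I c V = (\<Sum>i\<in>I. (\<lambda>n. c i * V i n))" for c
    by (simp add: fun_eq_iff lin_comb_def sum_fun_apply)
  show ?thesis
  proof (rule cseq.dim_unique[of "V ` I"])
    show "V ` I \<subseteq> range (\<lambda>c. lin_comb I c V)"
    proof
      fix y assume "y \<in> V ` I"
      then obtain i where i: "i \<in> I" "y = V i" by auto
      have "(\<Sum>k\<in>I. (if k = i then 1 else 0) * V k n) = (\<Sum>k\<in>I. if k = i then V k n else 0)" for n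
        by (intro sum.cong) auto
      then have "y = lin_comb I (\<lambda>k. if k = i then 1 else 0) V"
        using i I by (simp add: fun_eq_iff lin_comb_def)
      then show "y \<in> range (\<lambda>c. lin_comb I c V)" by blast
    qed
    show "range (\<lambda>c. lin_comb I c V) \<subseteq> cseq.span (V ` I)"
    proof
      fix y assume "y \<in> range (\<lambda>c. lin_comb I c V)"
      then obtain c where y: "y = (\<Sum>i\<in>I. (\<lambda>n. c i * V i n))" using lin by auto
      show "y \<in> cseq.span (V ` I)"
        unfolding y by (intro cseq.span_sum cseq.span_scale cseq.span_base imageI)
    qed
    show "cseq.independent (V ` I)"
    proof
      assume "cseq.dependent (V ` I)"
      then obtain u where u: "\<exists>v\<in>V ` I. u v \<noteq> 0" "(\<Sum>v\<in>V ` I. (\<lambda>n. u v * v n)) = 0"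
        using cseq.dependent_finite[of "V ` I"] I by auto
      have "lin_comb I (u \<circ> V) V = (\<lambda>_. 0)"
        using u(2) inj by (simp add: lin sum.reindex zero_fun_def)
      then show False using indep[of "u \<circ> V"] u(1) by auto
    qed
    show "card (V ` I) = card I" using inj by (rule card_image)
  qed
qed

lemma extend_comb:
  "extend N \<omega> a z b \<mu> (\<lambda>n. c * x n + x' n) = (\<lambda>n. c * extend N \<omega> a z b \<mu> x n + extend N \<omega> a z b \<mu> x' n)"
proof
  fix n
  show "extend N \<omega> a z b \<mu> (\<lambda>n. c * x n + x' n) n = c * extend N \<omega> a z b \<mu> x n + extend N \<omega> a z b \<mu> x' n"
    unfolding extend_def Let_def shear_comb residual_comb
    by (simp add: algebra_simps add_divide_distrib diff_divide_distrib)
qed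

lemma extend_zero: "extend N \<omega> a z b \<mu> (\<lambda>_. 0) = (\<lambda>_. 0)"
  by (auto simp: extend_def Let_def shear_def residual_def fun_eq_iff)

lemma extend_lin_comb:
  "extend N \<omega> a z b \<mu> (lin_comb I c v) = lin_comb I c (\<lambda>i. extend N \<omega> a z b \<mu> (v i))"
proof (induction I rule: infinite_finite_induct)
  case (insert i I)
  then have "extend N \<omega> a z b \<mu> (lin_comb (insert i I) c v)
      = extend N \<omega> a z b \<mu> (\<lambda>n. c i * v i n + lin_comb I c v n)"
    by (simp add: lin_comb_def [abs_def])
  then show ?case
    using insert by (simp add: extend_comb) (simp add: lin_comb_def [abs_def])
qed (simp_all add: lin_comb_def [abs_def] extend_zero)

lemma extend_eq_zero:
  assumes N: "N \<ge> 2" and x: "x \<in> supported {1..N}" and 0: "extend N \<omega> a z b \<mu> x = (\<lambda>_. 0)"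
  shows "x = (\<lambda>_. 0)"
proof
  have sh: "shear z N x n = 0" if "n \<in> {1..N}" for n
    using fun_cong[OF 0, of n] that by (simp add: extend_def Let_def)
  fix n show "x n = 0"
    using N x sh[of n] sh[of N] sh[of 1]
    by (cases "n \<in> {1..N}") (auto simp: shear_def supported_def split: if_splits)
qed

lemma problem_diagonalizable:
  assumes N: "N \<ge> 2" and \<omega>: "\<omega> \<in> Omega N"
  shows "\<exists>v l. diagonalized (active N \<omega> a) (pencil_form N \<omega> a z b) (sheared_weight N \<omega> z) v l"
proof (rule hermitian_pencil_diagonalizable[OF hermitian_pencil_form hermitian_sheared_weight])
  show "finite (active N \<omega> a)" by (simp add: active_def)
  show "0 < Re (sheared_weight N \<omega> z x x)" if "x \<in> supported (active N \<omega> a)" "x \<noteq> (\<lambda>_. 0)" for x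
    by (rule sheared_weight_pos[OF N \<omega>]) (use that in \<open>auto simp: active_def supported_def split: if_splits\<close>)
qed

text \<open>Since the \<open>l i\<close> are real and the forms Hermitian, an eigenvector for \<mu>
  is \<open>C\<close>-orthogonal to every \<open>v i\<close> with another eigenvalue. Its expansion
  therefore reduces to the indices with \<open>l i\<close> equal to \<mu>.\<close>

lemma solutions_eq_range:
  assumes N: "N \<ge> 2" and \<omega>: "\<omega> \<in> Omega N"
    and d: "diagonalized (active N \<omega> a) (pencil_form N \<omega> a z b) (sheared_weight N \<omega> z) v l"
  shows "solutions N (\<omega>, GL_class (normal_14 a z b)) \<mu> =
    range (\<lambda>c. lin_comb {i. i < card (active N \<omega> a) \<and> of_real (l i) = \<mu>} c (\<lambda>i. extend N \<omega> a z b \<mu> (v i)))"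
proof -
  define J where "J = active N \<omega> a"
  define I where "I = {i. i < card J \<and> complex_of_real (l i) = \<mu>}"
  define H where "H = pencil_form N \<omega> a z b"
  define C where "C = sheared_weight N \<omega> z"
  have H: "hermitian_form H" and C: "hermitian_form C"
    by (simp_all add: H_def C_def hermitian_pencil_form hermitian_sheared_weight)
  note d = d[folded J_def H_def C_def]
  have vS: "v i \<in> supported J" if "i < card J" for i using d that by (simp add: diagonalized_def)
  have eig: "H (v i) y = of_real (l i) * C (v i) y" if "i < card J" "y \<in> supported J" for i y
    using d that by (simp add: diagonalized_def)
  have "{x \<in> supported J. \<forall>y\<in>supported J. H x y = \<mu> * C x y} = range (\<lambda>c. lin_comb I c v)"
  proof (intro subset_antisym subsetI)
    fix x assume "x \<in> {x \<in> supported J. \<forall>y\<in>supported J. H x y = \<mu> * C x y}"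
    then have x: "x \<in> supported J" "\<And>y. y \<in> supported J \<Longrightarrow> H x y = \<mu> * C x y" by auto
    have "C x (v i) = 0" if i: "i < card J" "i \<notin> I" for i
    proof -
      have "H x (v i) = of_real (l i) * C x (v i)"
        using eig[OF i(1) x(1)] hermitian_form_cnj[OF H, of x "v i"] hermitian_form_cnj[OF C, of x "v i"] by simp
      with x(2)[OF vS[OF i(1)]] i show ?thesis by (simp add: I_def)
    qed
    then have "lin_comb {..<card J} (\<lambda>i. C x (v i)) v n = lin_comb I (\<lambda>i. C x (v i)) v n" for n
      unfolding lin_comb_def by (intro sum.mono_neutral_right) (auto simp: I_def)
    moreover have "lin_comb {..<card J} (\<lambda>i. C x (v i)) v = x" using d x(1) by (simp add: diagonalized_def)
    ultimately have "x = lin_comb I (\<lambda>i. C x (v i)) v" by auto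
    then show "x \<in> range (\<lambda>c. lin_comb I c v)" by blast
  next
    fix x assume "x \<in> range (\<lambda>c. lin_comb I c v)"
    then obtain c where x: "x = lin_comb I c v" by blast
    have "x \<in> supported J" unfolding x by (intro lin_comb_supported vS) (simp add: I_def)
    moreover have "H x y = \<mu> * C x y" if "y \<in> supported J" for y
      unfolding x hermitian_form_lin_comb[OF H] hermitian_form_lin_comb[OF C] sum_distrib_left
      by (intro sum.cong) (use eig that in \<open>auto simp: I_def\<close>)
    ultimately show "x \<in> {x \<in> supported J. \<forall>y\<in>supported J. H x y = \<mu> * C x y}" by blast
  qed
  then show ?thesis
    unfolding solutions_eq_extend[OF N \<omega>] J_def[symmetric] H_def[symmetric] C_def[symmetric] I_def[symmetric]
    by (simp add: image_image extend_lin_comb)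
qed

text \<open>\<open>extend\<close> is injective on \<open>supported {1..N}\<close>, so the
  orthonormality of the \<open>v i\<close> makes the extended vectors linearly independent.\<close>

lemma multiplicity_eq_card:
  assumes N: "N \<ge> 2" and \<omega>: "\<omega> \<in> Omega N"
    and d: "diagonalized (active N \<omega> a) (pencil_form N \<omega> a z b) (sheared_weight N \<omega> z) v l"
  shows "multiplicity_of N (\<omega>, GL_class (normal_14 a z b)) \<mu> = card {i. i < card (active N \<omega> a) \<and> of_real (l i) = \<mu>}"
    and "\<mu> \<in> eigenvalues N (\<omega>, GL_class (normal_14 a z b)) \<longleftrightarrow> (\<exists>i < card (active N \<omega> a). of_real (l i) = \<mu>)"
proof -
  define J where "J = active N \<omega> a"
  define I where "I = {i. i < card J \<and> complex_of_real (l i) = \<mu>}"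
  define V where "V = (\<lambda>i. extend N \<omega> a z b \<mu> (v i))"
  have I: "finite I" by (simp add: I_def)
  have sol: "solutions N (\<omega>, GL_class (normal_14 a z b)) \<mu> = range (\<lambda>c. lin_comb I c V)"
    using solutions_eq_range[OF assms, of \<mu>] by (simp add: I_def J_def V_def)
  have indep: "\<forall>i\<in>I. c i = 0" if 0: "lin_comb I c V = (\<lambda>_. 0)" for c
  proof
    have S: "lin_comb I c v \<in> supported {1..N}"
    proof (rule lin_comb_supported)
      fix i assume "i \<in> I"
      then have "v i \<in> supported J" using d by (simp add: I_def J_def diagonalized_def)
      then show "v i \<in> supported {1..N}" using active_subset[of N \<omega> a] by (auto simp: J_def supported_def)
    qed
    have z: "lin_comb I c v = (\<lambda>_. 0)"
      by (rule extend_eq_zero[OF N S]) (use 0 in \<open>simp add: extend_lin_comb V_def\<close>)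
    fix j assume j: "j \<in> I"
    have "0 = sheared_weight N \<omega> z (lin_comb I c v) (v j)"
      unfolding z by (simp add: hermitian_form_zero[OF hermitian_sheared_weight])
    also have "\<dots> = (\<Sum>i\<in>I. if i = j then c i else 0)"
      unfolding hermitian_form_lin_comb[OF hermitian_sheared_weight]
      by (intro sum.cong) (use d j in \<open>auto simp: I_def J_def diagonalized_def\<close>)
    finally show "c j = 0" using j I by simp
  qed
  show "multiplicity_of N (\<omega>, GL_class (normal_14 a z b)) \<mu> = card {i. i < card (active N \<omega> a) \<and> of_real (l i) = \<mu>}"
    unfolding multiplicity_of_def sol using dim_lin_comb[OF I indep] by (simp add: I_def J_def)
  have "\<mu> \<in> eigenvalues N (\<omega>, GL_class (normal_14 a z b)) \<longleftrightarrow> (\<exists>c. lin_comb I c V \<noteq> (\<lambda>_. 0))"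
    by (auto simp: eigenvalues_def sol zero_fun_def)
  also have "\<dots> \<longleftrightarrow> I \<noteq> {}"
  proof
    assume "I \<noteq> {}"
    then show "\<exists>c. lin_comb I c V \<noteq> (\<lambda>_. 0)" using indep[of "\<lambda>_. 1"] by (intro exI[of _ "\<lambda>_. 1"]) auto
  qed (auto simp: lin_comb_def)
  finally show "\<mu> \<in> eigenvalues N (\<omega>, GL_class (normal_14 a z b)) \<longleftrightarrow> (\<exists>i < card (active N \<omega> a). of_real (l i) = \<mu>)"
    by (auto simp: I_def J_def)
qed

lemma sum_replicate_mset_image:
  assumes "finite I"
  shows "(\<Sum>\<mu>\<in>g ` I. replicate_mset (card {i \<in> I. g i = \<mu>}) \<mu>) = image_mset g (mset_set I)"
proof (rule multiset_eqI)
  fix x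
  have "count (\<Sum>\<mu>\<in>g ` I. replicate_mset (card {i \<in> I. g i = \<mu>}) \<mu>) x =
      (\<Sum>\<mu>\<in>g ` I. if \<mu> = x then card {i \<in> I. g i = \<mu>} else 0)"
    by (auto simp: count_sum intro!: sum.cong)
  also have "\<dots> = card {i \<in> I. g i = x}"
    using assms by (auto simp: card_eq_0_iff)
  also have "\<dots> = count (image_mset g (mset_set I)) x"
    using assms by (simp add: count_image_mset Int_def vimage_def conj_commute)
  finally show "count (\<Sum>\<mu>\<in>g ` I. replicate_mset (card {i \<in> I. g i = \<mu>}) \<mu>) x = count (image_mset g (mset_set I)) x" .
qed

text \<open>The sequence \<open>l\<close> of a diagonalization is real and already sorted, so it
  coincides with the sorted listing behind \<open>eigval\<close>. Any diagonalization may thus be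
  used to compute it.\<close>

theorem spectrum_eq_diagonal:
  assumes N: "N \<ge> 2" and \<omega>: "\<omega> \<in> Omega N"
    and d: "diagonalized (active N \<omega> a) (pencil_form N \<omega> a z b) (sheared_weight N \<omega> z) v l"
  shows "has_exactly_eigenvalues N (\<omega>, GL_class (normal_14 a z b)) (card (active N \<omega> a))"
    and "n < card (active N \<omega> a) \<Longrightarrow> eigval N n (\<omega>, GL_class (normal_14 a z b)) = l n"
proof -
  define k where "k = card (active N \<omega> a)"
  define p where "p = (\<omega>, GL_class (normal_14 a z b))"
  have ev: "eigenvalues N p = (\<lambda>i. complex_of_real (l i)) ` {..<k}"
    using multiplicity_eq_card(2)[OF assms] by (auto simp: p_def k_def)
  have "spectrum N p = image_mset (\<lambda>i. complex_of_real (l i)) (mset_set {..<k})"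
    unfolding spectrum_def ev p_def multiplicity_eq_card(1)[OF assms] k_def
    by (subst sum_replicate_mset_image[symmetric]) (simp_all add: ev[unfolded p_def k_def])
  then have sp: "spectrum N p = mset (map (\<lambda>i. complex_of_real (l i)) [0..<k])"
    by (simp add: mset_map lessThan_atLeast0 flip: mset_upt)
  show "has_exactly_eigenvalues N (\<omega>, GL_class (normal_14 a z b)) (card (active N \<omega> a))"
    unfolding has_exactly_eigenvalues_def p_def[symmetric] k_def[symmetric]
    by (auto simp: ev sp)
  have "sorted (map l [0..<k])"
    using d by (auto simp: sorted_iff_nth_mono diagonalized_def k_def)
  moreover have "image_mset Re (spectrum N p) = mset (map l [0..<k])"
    by (simp add: sp flip: mset_map) (simp add: o_def)
  ultimately have "sorted_list_of_multiset (image_mset Re (spectrum N p)) = map l [0..<k]"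
    by (simp only: sorted_list_of_multiset_mset sorted_sort_id)
  then show "eigval N n (\<omega>, GL_class (normal_14 a z b)) = l n" if "n < card (active N \<omega> a)"
    using that by (simp add: eigval_def p_def k_def)
qed

section \<open>The topology of the boundary conditions\<close>

definition minor2 :: "4 \<Rightarrow> 4 \<Rightarrow> complex^4^2 \<Rightarrow> complex" where
  "minor2 i j M = M $ 1 $ i * M $ 2 $ j - M $ 1 $ j * M $ 2 $ i"

text \<open>Ratios of Pluecker coordinates are functions on the quotient, and they recover the entries
  \<open>a\<close>, \<open>z\<close>, \<open>b\<close> of the normal form.\<close>

definition pluecker :: "4 \<Rightarrow> 4 \<Rightarrow> (complex^4^2) set \<Rightarrow> complex" where
  "pluecker i j c = (let M = (SOME M. M \<in> c) in minor2 i j M / minor2 1 4 M)"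

lemma minor2_mult: "minor2 i j (G ** M) = det G * minor2 i j M"
  by (simp add: minor2_def det_2 matrix_matrix_mult_def sum_2 algebra_simps)

lemma minor2_class:
  assumes "M' \<in> GL_class M"
  obtains d where "d \<noteq> 0" "\<And>i j. minor2 i j M' = d * minor2 i j M"
  using assms unfolding GL_class_def by (force simp: minor2_mult invertible_det_nz)

text \<open>All representatives have the same minors up to a common nonzero determinant, which
  cancels in the ratio; the choice made by \<open>SOME\<close> is harmless.\<close>

lemma pluecker_class: "pluecker i j (GL_class M) = minor2 i j M / minor2 1 4 M"
proof -
  have "(SOME M'. M' \<in> GL_class M) \<in> GL_class M" by (rule someI) (rule GL_class_self)
  then obtain d where "d \<noteq> 0" "\<And>i j. minor2 i j (SOME M'. M' \<in> GL_class M) = d * minor2 i j M"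
    using minor2_class by blast
  then show ?thesis by (simp add: pluecker_def Let_def)
qed

lemma minor2_normal_14:
  "minor2 1 4 (normal_14 a z b) = 1" "minor2 2 4 (normal_14 a z b) = of_real a"
  "minor2 1 2 (normal_14 a z b) = z" "minor2 1 3 (normal_14 a z b) = of_real b"
  by (simp_all add: minor2_def normal_14_def)

lemma pluecker_normal_14:
  "pluecker 2 4 (GL_class (normal_14 a z b)) = of_real a"
  "pluecker 1 2 (GL_class (normal_14 a z b)) = z"
  "pluecker 1 3 (GL_class (normal_14 a z b)) = of_real b"
  by (simp_all add: pluecker_class minor2_normal_14)

text \<open>The conditions on the minors are invariant under GL(2,C), so the set of matrices is
  saturated: the preimage of its image is the set itself, which is relatively open.\<close>

lemma openin_quotient_pluecker:
  assumes "open V"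
  shows "openin quotient_top (GL_class ` {M \<in> rank2_matrices. minor2 1 4 M \<noteq> 0 \<and> minor2 i j M / minor2 1 4 M \<in> V})"
    (is "openin _ (GL_class ` ?R)")
proof -
  have cont: "continuous_on S (minor2 i j)" for S i j
    unfolding minor2_def by (intro continuous_intros)
  have op: "open {M. minor2 1 4 M \<noteq> 0}"
    by (intro open_Collect_neq cont continuous_on_const)
  have "open ({M. minor2 1 4 M \<noteq> 0} \<inter> (\<lambda>M. minor2 i j M / minor2 1 4 M) -` V)"
    by (intro continuous_open_preimage continuous_intros cont op assms) auto
  moreover have "rank2_matrices \<inter> GL_class -` (GL_class ` ?R) =
      rank2_matrices \<inter> ({M. minor2 1 4 M \<noteq> 0} \<inter> (\<lambda>M. minor2 i j M / minor2 1 4 M) -` V)"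
  proof (intro subset_antisym subsetI)
    fix M assume "M \<in> rank2_matrices \<inter> GL_class -` (GL_class ` ?R)"
    then obtain M' where M: "M \<in> rank2_matrices" "GL_class M = GL_class M'" "M' \<in> ?R" by auto
    have "M \<in> GL_class M'" using GL_class_self[of M] M(2) by simp
    then obtain d where "d \<noteq> 0" "\<And>i j. minor2 i j M = d * minor2 i j M'" using minor2_class by blast
    with M show "M \<in> rank2_matrices \<inter> ({M. minor2 1 4 M \<noteq> 0} \<inter> (\<lambda>M. minor2 i j M / minor2 1 4 M) -` V)"
      by auto
  qed auto
  ultimately show ?thesis by (auto simp: openin_quotient_top)
qed

section \<open>The chart of normal forms\<close>

lemma GL_class_mult:
  assumes "invertible G" shows "GL_class (G ** M) = GL_class M"
proof -
  obtain G' where G': "G ** G' = mat 1" "G' ** G = mat 1" using assms by (auto simp: invertible_def)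
  have "H ** (G ** M) \<in> GL_class M" if "invertible H" for H
    using that assms unfolding GL_class_def matrix_mul_assoc by (blast intro: invertible_mult)
  moreover have "H ** M \<in> GL_class (G ** M)" if "invertible H" for H
  proof -
    have "H ** M = (H ** G') ** (G ** M)" by (metis G'(2) matrix_mul_assoc matrix_mul_rid)
    moreover have "invertible (H ** G')" using that G' by (intro invertible_mult) (auto simp: invertible_def)
    ultimately show ?thesis unfolding GL_class_def by blast
  qed
  ultimately show ?thesis unfolding GL_class_def by blast
qed

lemma self_adjoint_bc_mult:
  assumes "self_adjoint_bc M" shows "self_adjoint_bc (G ** M)"
proof -
  have l: "left_block (G ** M) = G ** left_block M" and r: "right_block (G ** M) = G ** right_block M"
    by (simp_all add: left_block_def right_block_def matrix_matrix_mult_def vec_eq_iff forall_2)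
  have adj: "adjoint_matrix (A ** B) = adjoint_matrix B ** adjoint_matrix A" for A B
    by (simp add: adjoint_matrix_def matrix_matrix_mult_def map_matrix_def transpose_def vec_eq_iff mult.commute)
  have *: "(G ** A) ** J_mat ** (adjoint_matrix A ** adjoint_matrix G) =
      G ** (A ** J_mat ** adjoint_matrix A) ** adjoint_matrix G" for A
    by (simp add: matrix_mul_assoc)
  show ?thesis using assms unfolding self_adjoint_bc_def l r adj * by simp
qed

lemma self_adjoint_bc_normal_14: "self_adjoint_bc (normal_14 a z b)"
  by (simp add: self_adjoint_bc_def normal_14_def left_block_def right_block_def J_mat_def
      adjoint_matrix_def map_matrix_def transpose_def matrix_matrix_mult_def vec_eq_iff forall_2 sum_2)

lemma rank_normal_14: "rank (normal_14 a z b) = 2"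
proof -
  define M where "M = normal_14 a z b"
  have rows: "rows M = {M $ 1, M $ 2}"
    by (auto simp: rows_def row_def exhaust_2) (metis exhaust_2)
  have c: "M $ 1 $ 1 = 1" "M $ 2 $ 1 = 0" "M $ 1 $ 4 = 0" "M $ 2 $ 4 = 1"
    by (simp_all add: M_def normal_14_def)
  then have ne: "M $ 1 \<noteq> M $ 2" by auto
  have "vec.independent (rows M)"
  proof
    assume "vec.dependent (rows M)"
    then obtain u where u: "\<exists>v\<in>rows M. u v \<noteq> 0" "(\<Sum>v\<in>rows M. u v *s v) = 0"
      using vec.dependent_finite[of "rows M"] by (auto simp: rows)
    have "u (M $ 1) *s (M $ 1) + u (M $ 2) *s (M $ 2) = 0" using u(2) ne by (simp add: rows)
    then have "u (M $ 1) * M $ 1 $ k + u (M $ 2) * M $ 2 $ k = 0" for k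
      by (metis vector_add_component vector_smult_component zero_index)
    \<comment> \<open>Columns 1 and 4 form the identity matrix, so they read off the two
      coefficients.\<close>
    from this[of 1] this[of 4] u(1) c show False by (auto simp: rows)
  qed
  then have "rank M = card (rows M)" by (simp add: row_rank_def_gen vec.dim_eq_card_independent)
  then show ?thesis using ne unfolding M_def[symmetric] by (simp add: rows)
qed

lemma normal_14_rank2: "normal_14 a z b \<in> rank2_matrices"
  by (simp add: rank2_matrices_def rank_normal_14)

lemma normal_14_BC: "GL_class (normal_14 a z b) \<in> BC"
  unfolding BC_def using normal_14_rank2 self_adjoint_bc_normal_14 by blast

text \<open>Multiplying by the inverse of the block of columns 1 and 4 makes this block the
  identity. Self-adjointness then says exactly that the entries \<open>a\<close> and
  \<open>b\<close> are real and the two remaining ones conjugate.\<close>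

lemma self_adjoint_normal_form:
  assumes "self_adjoint_bc M" "minor2 1 4 M \<noteq> 0"
  shows "\<exists>a z b. GL_class M = GL_class (normal_14 a z b)"
proof -
  define K :: "complex^2^2" where "K = vector [vector [M $ 1 $ 1, M $ 1 $ 4], vector [M $ 2 $ 1, M $ 2 $ 4]]"
  have "det K \<noteq> 0" using assms(2) by (simp add: det_2 K_def minor2_def)
  then obtain G where G: "G ** K = mat 1" "K ** G = mat 1" by (metis invertible_det_nz invertible_def)
  have inv: "invertible G" using G by (auto simp: invertible_def)
  define L where "L = G ** M"
  have GK: "G $ i $ 1 * M $ 1 $ 1 + G $ i $ 2 * M $ 2 $ 1 = (if i = 1 then 1 else 0)"
    "G $ i $ 1 * M $ 1 $ 4 + G $ i $ 2 * M $ 2 $ 4 = (if i = 2 then 1 else 0)" for i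
    using arg_cong[OF G(1), of "\<lambda>A. A $ i $ 1"] arg_cong[OF G(1), of "\<lambda>A. A $ i $ 2"]
    by (simp_all add: matrix_matrix_mult_def K_def sum_2 mat_def)
  have L: "L $ 1 $ 1 = 1" "L $ 2 $ 1 = 0" "L $ 1 $ 4 = 0" "L $ 2 $ 4 = 1"
    using GK[of 1] GK[of 2] by (simp_all add: L_def matrix_matrix_mult_def sum_2)
  have "self_adjoint_bc L" unfolding L_def by (rule self_adjoint_bc_mult[OF assms(1)])
  then have sa: "cnj (L $ 1 $ 2) = L $ 1 $ 2" "cnj (L $ 2 $ 2) = L $ 1 $ 3" "cnj (L $ 2 $ 3) = L $ 2 $ 3"
    by (simp_all add: self_adjoint_bc_def left_block_def right_block_def J_mat_def
      adjoint_matrix_def map_matrix_def transpose_def matrix_matrix_mult_def vec_eq_iff forall_2 sum_2 L)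
  have "L = normal_14 (Re (L $ 1 $ 2)) (L $ 2 $ 2) (Re (L $ 2 $ 3))"
    using sa L by (simp add: normal_14_def vec_eq_iff forall_2 forall_4 complex_eq_iff)
  then show ?thesis using GL_class_mult[OF inv, of M] by (metis L_def)
qed

text \<open>Nonvanishing of the minor does not depend on the representative, and it provides a
  normal form. Membership in \<open>UNIV\<close> gives the set the shape of the open sets of
  \<open>openin_quotient_pluecker\<close>.\<close>

lemma O14_eq: "O14 = BC \<inter> GL_class ` {M \<in> rank2_matrices. minor2 1 4 M \<noteq> 0 \<and> minor2 i j M / minor2 1 4 M \<in> UNIV}"
proof (intro subset_antisym subsetI)
  fix c assume "c \<in> O14"
  then show "c \<in> BC \<inter> GL_class ` {M \<in> rank2_matrices. minor2 1 4 M \<noteq> 0 \<and> minor2 i j M / minor2 1 4 M \<in> UNIV}"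
    using normal_14_BC normal_14_rank2 minor2_normal_14(1) by (fastforce simp: O14_def)
next
  fix c assume "c \<in> BC \<inter> GL_class ` {M \<in> rank2_matrices. minor2 1 4 M \<noteq> 0 \<and> minor2 i j M / minor2 1 4 M \<in> UNIV}"
  then obtain M M' where M: "c = GL_class M" "minor2 1 4 M \<noteq> 0" "c = GL_class M'" "self_adjoint_bc M'"
    by (auto simp: BC_def)
  then have "M \<in> GL_class M'" using GL_class_self[of M] by simp
  then obtain d where "d \<noteq> 0" "\<And>i j. minor2 i j M = d * minor2 i j M'" using minor2_class by blast
  with M(2) have "minor2 1 4 M' \<noteq> 0" by auto
  from self_adjoint_normal_form[OF M(4) this] show "c \<in> O14" by (auto simp: O14_def M(3))
qed

lemma openin_BC_pluecker:
  assumes "open V"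
  shows "openin BC_top {c \<in> O14. pluecker i j c \<in> V}"
proof -
  have "{c \<in> O14. pluecker i j c \<in> V} =
      GL_class ` {M \<in> rank2_matrices. minor2 1 4 M \<noteq> 0 \<and> minor2 i j M / minor2 1 4 M \<in> V} \<inter> BC"
    by (auto simp: O14_eq[of i j] pluecker_class)
  then show ?thesis
    unfolding BC_top_def openin_subtopology using openin_quotient_pluecker[OF assms] by blast
qed

section \<open>Limits of the coefficients of a problem\<close>

lemma topspace_Omega_top: "topspace (Omega_top N) = Omega N"
  by (auto simp: Omega_top_def Omega_def PiE_def)

lemma topspace_BC_top: "topspace BC_top = BC"
  by (auto simp: BC_top_def topspace_quotient_top BC_def)

lemma topspace_problem_top: "topspace (problem_top N) = Omega N \<times> BC"
  by (simp add: problem_top_def topspace_Omega_top topspace_BC_top)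

text \<open>The chart is open among all problems, so a limit taken in the full space only sees
  problems in normal form.\<close>

lemma eventually_pluecker:
  assumes "open V" "pluecker i j (snd p0) \<in> V" "p0 \<in> Omega N \<times> O14"
  shows "\<forall>\<^sub>F p in atin_within (problem_top N) p0 S. p \<in> Omega N \<times> O14 \<and> pluecker i j (snd p) \<in> V"
proof -
  have "openin (problem_top N) (Omega N \<times> {c \<in> O14. pluecker i j c \<in> V})"
    unfolding problem_top_def openin_prod_Times_iff
    using openin_BC_pluecker[OF assms(1)] openin_topspace[of "Omega_top N"] by (simp add: topspace_Omega_top)
  moreover have "p0 \<in> Omega N \<times> {c \<in> O14. pluecker i j c \<in> V}"
    using assms(2,3) by (simp add: mem_Times_iff)
  ultimately show ?thesis
    unfolding eventually_atin_within
    by (intro disjI2 exI[of _ "Omega N \<times> {c \<in> O14. pluecker i j c \<in> V}"]) (simp add: mem_Times_iff)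
qed

lemma tendsto_pluecker:
  assumes "p0 \<in> Omega N \<times> O14"
  shows "((\<lambda>p. pluecker i j (snd p)) \<longlongrightarrow> pluecker i j (snd p0)) (atin_within (problem_top N) p0 S)"
proof (rule topological_tendstoI)
  fix V assume "open V" "pluecker i j (snd p0) \<in> V"
  from eventually_pluecker[OF this assms, of S]
  show "\<forall>\<^sub>F p in atin_within (problem_top N) p0 S. pluecker i j (snd p) \<in> V"
    by (rule eventually_mono) simp
qed

lemma tendsto_of_continuous_map:
  assumes "continuous_map X euclidean g" "a \<in> topspace X"
  shows "(g \<longlongrightarrow> g a) (atin_within X a S)"
proof (rule topological_tendstoI)
  fix V assume V: "open V" "g a \<in> V"
  then have "openin X {x \<in> topspace X. g x \<in> V}"
    using assms(1) openin_continuous_map_preimage open_openin by blast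
  then show "\<forall>\<^sub>F x in atin_within X a S. g x \<in> V"
    unfolding eventually_atin_within using assms(2) V(2) by blast
qed

text \<open>The topology is that of the stored values, which are the reciprocals of f. Thus 1/f_0 is
  itself a coordinate, and f converges because the stored limit is nonzero.\<close>

lemma tendsto_equation:
  fixes S :: "problem set"
  assumes "p0 \<in> Omega N \<times> O14"
  defines "F \<equiv> atin_within (problem_top N) p0 S"
  shows "n \<le> N \<Longrightarrow> ((\<lambda>p. f_of (fst p) n) \<longlongrightarrow> f_of (fst p0) n) F"
    and "((\<lambda>p. 1 / f_of (fst p) 0) \<longlongrightarrow> 1 / f_of (fst p0) 0) F"
    and "n \<in> {1..N} \<Longrightarrow> ((\<lambda>p. q_of (fst p) n) \<longlongrightarrow> q_of (fst p0) n) F"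
    and "n \<in> {1..N} \<Longrightarrow> ((\<lambda>p. w_of (fst p) n) \<longlongrightarrow> w_of (fst p0) n) F"
proof -
  have p0: "p0 \<in> topspace (problem_top N)"
    using assms(1) O14_eq[of 1 1] by (auto simp: topspace_problem_top)
  have fst: "continuous_map (problem_top N) (Omega_top N) fst"
    unfolding problem_top_def by (rule continuous_map_fst)
  have A: "continuous_map (problem_top N) euclideanreal (\<lambda>p. fst (fst p) n)" if "n \<in> {0..N}" for n
    by (rule continuous_map_compose[OF fst, of _ "\<lambda>\<omega>. fst \<omega> n", unfolded o_def])
       (use that in \<open>auto simp: Omega_top_def intro!: continuous_map_from_subtopology
          continuous_map_compose[OF continuous_map_fst continuous_map_product_projection, unfolded o_def]\<close>)
  have B: "continuous_map (problem_top N) euclideanreal (\<lambda>p. q_of (fst p) n)" if "n \<in> {1..N}" for n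
    by (rule continuous_map_compose[OF fst, of _ "\<lambda>\<omega>. q_of \<omega> n", unfolded o_def])
       (use that in \<open>auto simp: Omega_top_def q_of_def intro!: continuous_map_from_subtopology
          continuous_map_compose[OF continuous_map_snd continuous_map_compose[OF continuous_map_fst
            continuous_map_product_projection], unfolded o_def]\<close>)
  have C: "continuous_map (problem_top N) euclideanreal (\<lambda>p. w_of (fst p) n)" if "n \<in> {1..N}" for n
    by (rule continuous_map_compose[OF fst, of _ "\<lambda>\<omega>. w_of \<omega> n", unfolded o_def])
       (use that in \<open>auto simp: Omega_top_def w_of_def intro!: continuous_map_from_subtopology
          continuous_map_compose[OF continuous_map_snd continuous_map_compose[OF continuous_map_snd
            continuous_map_product_projection], unfolded o_def]\<close>)
  show "n \<in> {1..N} \<Longrightarrow> ((\<lambda>p. q_of (fst p) n) \<longlongrightarrow> q_of (fst p0) n) F"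
    "n \<in> {1..N} \<Longrightarrow> ((\<lambda>p. w_of (fst p) n) \<longlongrightarrow> w_of (fst p0) n) F"
    unfolding F_def using tendsto_of_continuous_map[OF B p0] tendsto_of_continuous_map[OF C p0] by auto
  have r: "((\<lambda>p. fst (fst p) n) \<longlongrightarrow> fst (fst p0) n) F" if "n \<le> N" for n
    unfolding F_def using tendsto_of_continuous_map[OF A p0] that by auto
  from r[of 0] show "((\<lambda>p. 1 / f_of (fst p) 0) \<longlongrightarrow> 1 / f_of (fst p0) 0) F" by (simp add: f_of_def)
  assume n: "n \<le> N"
  have "fst (fst p0) n \<noteq> 0" using Omega_f_nonzero[of "fst p0" N n] n assms(1) by (auto simp: f_of_def)
  then show "((\<lambda>p. f_of (fst p) n) \<longlongrightarrow> f_of (fst p0) n) F"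
    unfolding f_of_def by (intro tendsto_intros r n)
qed

text \<open>Moving the entry \<open>a\<close> reaches the other side of the hypersurface arbitrarily close to it.\<close>

lemma P14_plus_limit_point:
  assumes "p0 \<in> P14 N"
  shows "atin_within (problem_top N) p0 (P14_plus N) \<noteq> bot"
proof -
  obtain \<omega> z b where p0: "p0 = (\<omega>, GL_class (normal_14 (1 / f_of \<omega> 0) z b))" and \<omega>: "\<omega> \<in> Omega N"
    using assms by (auto simp: P14_def)
  define a where "a = 1 / f_of \<omega> 0"
  have "\<exists>p\<in>T. p \<in> P14_plus N \<and> p \<noteq> p0" if T: "openin (problem_top N) T" "p0 \<in> T" for T
  proof -
    obtain U W where UW: "openin (Omega_top N) U" "openin BC_top W" "p0 \<in> U \<times> W" "U \<times> W \<subseteq> T"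
      using T unfolding problem_top_def openin_prod_topology_alt p0 by (metis SigmaI)
    obtain W' where W': "openin quotient_top W'" "W = W' \<inter> BC"
      using UW(2) unfolding BC_top_def openin_subtopology by blast
    have "openin (top_of_set rank2_matrices) (rank2_matrices \<inter> GL_class -` W')"
      using W'(1) unfolding openin_quotient_top by blast
    moreover have "normal_14 a z b \<in> rank2_matrices \<inter> GL_class -` W'"
      using UW(3) W'(2) normal_14_rank2 by (auto simp: p0 a_def)
    ultimately obtain e where e: "e > 0"
      "\<And>M. M \<in> rank2_matrices \<Longrightarrow> dist M (normal_14 a z b) < e \<Longrightarrow> GL_class M \<in> W'"
      unfolding openin_euclidean_subtopology_iff by blast
    \<comment> \<open>Half the radius. Raising the single entry \<open>a\<close> by \<open>s\<close>
      moves the matrix by exactly \<open>s\<close>, hence inside the ball.\<close>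
    define s where "s = e / 2"
    have s: "s > 0" "s < e" using e(1) by (auto simp: s_def)
    have "normal_14 (a + s) z b - normal_14 a z b = axis 1 (axis 2 (of_real s))"
      by (simp add: normal_14_def vec_eq_iff forall_2 forall_4 axis_def)
    then have "dist (normal_14 (a + s) z b) (normal_14 a z b) = s"
      using s by (simp add: dist_norm norm_vec_def L2_set_def sum_2 sum_4 axis_def)
    then have "GL_class (normal_14 (a + s) z b) \<in> W"
      using e(2)[OF normal_14_rank2] s normal_14_BC W'(2) by auto
    then have "(\<omega>, GL_class (normal_14 (a + s) z b)) \<in> T" using UW(3,4) by (auto simp: p0)
    moreover have "(\<omega>, GL_class (normal_14 (a + s) z b)) \<in> P14_plus N"
      using \<omega> s unfolding P14_plus_def a_def by force
    moreover have "GL_class (normal_14 (a + s) z b) \<noteq> GL_class (normal_14 a z b)"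
      using pluecker_normal_14(1)[of "a + s" z b] pluecker_normal_14(1)[of a z b] s by auto
    ultimately show ?thesis unfolding p0 a_def by blast
  qed
  moreover have "p0 \<in> topspace (problem_top N)" using \<omega> normal_14_BC by (simp add: p0 topspace_problem_top)
  ultimately show ?thesis unfolding trivial_limit_def eventually_atin_within by blast
qed

section \<open>Eigenvalues near the hypersurface\<close>

text \<open>Total functions on problems, so that limits can be stated without choosing normal forms;
  on the chart they are its real or complex entries.\<close>

definition bc_a :: "problem \<Rightarrow> real" where "bc_a p = Re (pluecker 2 4 (snd p))"
definition bc_z :: "problem \<Rightarrow> complex" where "bc_z p = pluecker 1 2 (snd p)"
definition bc_b :: "problem \<Rightarrow> real" where "bc_b p = Re (pluecker 1 3 (snd p))"

text \<open>The \<epsilon> of the overview. It is positive on \<open>P14_minus\<close>, so there the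
  penalty \<open>1 / gap\<close> tends to plus infinity, and on \<open>P14_plus\<close> to minus
  infinity.\<close>

definition gap :: "problem \<Rightarrow> real" where "gap p = 1 / f_of (fst p) 0 - bc_a p"

definition reduced_energy where
  "reduced_energy N p = sheared_energy N (fst p) (bc_z p) (bc_b p)"

definition reduced_weight where
  "reduced_weight N p = sheared_weight N (fst p) (bc_z p)"

lemma problem_normal_form:
  assumes "p \<in> Omega N \<times> O14"
  shows "p = (fst p, GL_class (normal_14 (bc_a p) (bc_z p) (bc_b p)))"
  using assms by (auto simp: O14_def bc_a_def bc_z_def bc_b_def pluecker_normal_14)

lemma P14_iff:
  "p \<in> P14 N \<longleftrightarrow> p \<in> Omega N \<times> O14 \<and> gap p = 0"
  "p \<in> P14_plus N \<longleftrightarrow> p \<in> Omega N \<times> O14 \<and> gap p < 0"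
  "p \<in> P14_minus N \<longleftrightarrow> p \<in> Omega N \<times> O14 \<and> gap p > 0"
  by (cases p; fastforce simp: P14_def P14_plus_def P14_minus_def O14_def gap_def bc_a_def pluecker_normal_14)+

lemma hermitian_reduced:
  "hermitian_form (reduced_energy N p)" "hermitian_form (reduced_weight N p)"
  by (simp_all add: reduced_energy_def reduced_weight_def hermitian_sheared_energy hermitian_sheared_weight)

lemma diagonalized_cong_eigenvalues:
  assumes "diagonalized J B C v l" "\<And>i. i < card J \<Longrightarrow> l' i = l i"
  shows "diagonalized J B C v l'"
  using assms by (auto simp: diagonalized_def)

text \<open>This puts \<open>eigval\<close> itself in the place of the sequence \<open>l\<close>, so
  that the perturbation theorems speak about it directly.\<close>

lemma problem_spectrum:
  assumes N: "N \<ge> 2" and p: "p \<in> Omega N \<times> O14"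
  defines "J \<equiv> if gap p = 0 then {2..N} else {1..N}"
  shows "has_exactly_eigenvalues N p (card J)"
    and "\<exists>v. diagonalized J (add_penalty 1 (1 / gap p) (reduced_energy N p)) (reduced_weight N p) v (\<lambda>n. eigval N n p)"
proof -
  have \<omega>: "fst p \<in> Omega N" using p by auto
  have J: "active N (fst p) (bc_a p) = J" by (auto simp: J_def active_def gap_def)
  note nf = problem_normal_form[OF p]
  obtain v l where d: "diagonalized (active N (fst p) (bc_a p)) (pencil_form N (fst p) (bc_a p) (bc_z p) (bc_b p))
      (sheared_weight N (fst p) (bc_z p)) v l"
    using problem_diagonalizable[OF N \<omega>] by blast
  note sp = spectrum_eq_diagonal[OF N \<omega> d, folded nf, unfolded J]
  show "has_exactly_eigenvalues N p (card J)" by (rule sp(1))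
  have "diagonalized J (add_penalty 1 (1 / gap p) (reduced_energy N p)) (reduced_weight N p) v l"
    using d[unfolded J] by (simp add: pencil_form_def gap_def reduced_energy_def reduced_weight_def)
  then show "\<exists>v. diagonalized J (add_penalty 1 (1 / gap p) (reduced_energy N p)) (reduced_weight N p) v (\<lambda>n. eigval N n p)"
    using diagonalized_cong_eigenvalues[where l'="\<lambda>n. eigval N n p"] sp(2) by blast
qed

lemma singular_problem_diagonalized:
  assumes "N \<ge> 2" "p \<in> P14 N"
  shows "\<exists>v. diagonalized {2..N} (reduced_energy N p) (reduced_weight N p) v (\<lambda>n. eigval N n p)"
proof -
  have p: "p \<in> Omega N \<times> O14" "gap p = 0" using assms(2) by (auto simp: P14_iff)
  have "add_penalty 1 (1 / gap p) (reduced_energy N p) = reduced_energy N p"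
    by (simp add: p(2) add_penalty_def fun_eq_iff)
  with problem_spectrum(2)[OF assms(1) p(1)] p(2) show ?thesis by simp
qed

lemma regular_problem_diagonalized:
  assumes "N \<ge> 2" "p \<in> Omega N \<times> O14" "gap p \<noteq> 0"
  shows "\<exists>v. diagonalized {1..N} (add_penalty 1 (1 / gap p) (reduced_energy N p)) (reduced_weight N p) v (\<lambda>n. eigval N n p)"
  using problem_spectrum(2)[OF assms(1,2)] assms(3) by simp

text \<open>The penalty coefficient \<open>1 / gap\<close> is kept out of the convergent data
  because it has no limit at the hypersurface; only \<open>gap\<close> itself converges.\<close>

lemma problem_tendsto:
  fixes S :: "problem set"
  assumes N: "N \<ge> 2" and p0: "p0 \<in> Omega N \<times> O14"
  defines "F \<equiv> atin_within (problem_top N) p0 S"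
  shows "((\<lambda>p. reduced_energy N p x y) \<longlongrightarrow> reduced_energy N p0 x y) F"
    and "((\<lambda>p. reduced_weight N p x y) \<longlongrightarrow> reduced_weight N p0 x y) F"
    and "(gap \<longlongrightarrow> gap p0) F"
    and "\<forall>\<^sub>F p in F. p \<in> Omega N \<times> O14"
proof -
  note eqn = tendsto_equation[OF p0, where S=S, folded F_def]
  note pl = tendsto_pluecker[OF p0, where S=S, folded F_def]
  have a: "(bc_a \<longlongrightarrow> bc_a p0) F" and z: "(bc_z \<longlongrightarrow> bc_z p0) F" and b: "(bc_b \<longlongrightarrow> bc_b p0) F"
    unfolding bc_a_def [abs_def] bc_z_def [abs_def] bc_b_def [abs_def] by (intro tendsto_intros pl)+
  have sh: "((\<lambda>p. shear (bc_z p) N x n) \<longlongrightarrow> shear (bc_z p0) N x n) F" for x n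
    unfolding shear_def by (cases "n = 1") (auto intro!: tendsto_intros z)
  show "((\<lambda>p. reduced_energy N p x y) \<longlongrightarrow> reduced_energy N p0 x y) F"
    unfolding reduced_energy_def sheared_energy_def energy_def by (intro tendsto_intros sh b eqn) auto
  show "((\<lambda>p. reduced_weight N p x y) \<longlongrightarrow> reduced_weight N p0 x y) F"
    unfolding reduced_weight_def sheared_weight_def weight_def by (intro tendsto_intros sh eqn)
  show "(gap \<longlongrightarrow> gap p0) F"
    unfolding gap_def [abs_def] by (intro tendsto_diff eqn a)
  show "\<forall>\<^sub>F p in F. p \<in> Omega N \<times> O14"
    using eventually_pluecker[OF open_UNIV _ p0, of 1 1 S] by (simp add: F_def)
qed

text \<open>Near \<open>p0\<close> the gap stays nonzero, so the index set does not change and the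
  penalty coefficient converges as well.\<close>

lemma eigval_tendsto_regular:
  assumes N: "N \<ge> 2" and p0: "p0 \<in> Omega N \<times> O14" "gap p0 \<noteq> 0" and n: "n < N"
  shows "(eigval N n \<longlongrightarrow> eigval N n p0) (atin_within (problem_top N) p0 S)"
proof -
  note lim = problem_tendsto[OF N p0(1), where S=S]
  obtain v0 where v0: "diagonalized {1..N} (add_penalty 1 (1 / gap p0) (reduced_energy N p0)) (reduced_weight N p0) v0
      (\<lambda>n. eigval N n p0)"
    using regular_problem_diagonalized[OF N p0] by blast
  have "\<forall>\<^sub>F p in atin_within (problem_top N) p0 S. gap p \<noteq> 0"
    using lim(3) p0(2) by (rule tendsto_imp_eventually_ne)
  with lim(4) have "\<forall>\<^sub>F p in atin_within (problem_top N) p0 S. \<exists>v. diagonalized {1..N}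
      (add_penalty 1 (1 / gap p) (reduced_energy N p)) (reduced_weight N p) v (\<lambda>n. eigval N n p)"
    by eventually_elim (rule regular_problem_diagonalized[OF N])
  then show ?thesis
    by (rule diagonalized_tendsto[where l="\<lambda>p n. eigval N n p" and n=n, OF hermitian_form_add_penalty[OF hermitian_reduced(1)] hermitian_reduced(2) finite_atLeastAtMost v0])
       (use n p0(2) in \<open>auto simp: add_penalty_def intro!: tendsto_intros lim\<close>)
qed

lemma eventually_atin_within_self: "\<forall>\<^sub>F x in atin_within X a S. x \<in> S"
  unfolding eventually_atin_within by blast

lemma eigval_tendsto_P14:
  assumes N: "N \<ge> 2" and p0: "p0 \<in> P14 N" and n: "n < N - 1"
  shows "(eigval N n \<longlongrightarrow> eigval N n p0) (atin_within (problem_top N) p0 (P14 N))"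
proof -
  have p0': "p0 \<in> Omega N \<times> O14" using p0 by (simp add: P14_iff)
  note lim = problem_tendsto[OF N p0']
  obtain v0 where v0: "diagonalized {2..N} (reduced_energy N p0) (reduced_weight N p0) v0 (\<lambda>n. eigval N n p0)"
    using singular_problem_diagonalized[OF N p0] by blast
  have "\<forall>\<^sub>F p in atin_within (problem_top N) p0 (P14 N). \<exists>v. diagonalized {2..N}
      (reduced_energy N p) (reduced_weight N p) v (\<lambda>n. eigval N n p)"
    using eventually_atin_within_self by (rule eventually_mono) (rule singular_problem_diagonalized[OF N])
  then show ?thesis
    by (rule diagonalized_tendsto[where l="\<lambda>p n. eigval N n p" and n=n, OF hermitian_reduced finite_atLeastAtMost v0]) (use n in \<open>auto intro!: lim\<close>)
qed

text \<open>The penalty theorems apply with \<open>a = 1\<close> and \<open>J0 = {2..N}\<close>.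
  This set has \<open>N - 1\<close> elements, so on the minus side index \<open>N - 1\<close>
  escapes at the top, and on the plus side index 0 at the bottom.\<close>

lemma eigval_tendsto_singular:
  assumes N: "N \<ge> 2" and p0: "p0 \<in> P14 N"
  shows "n < N - 1 \<Longrightarrow> (eigval N n \<longlongrightarrow> eigval N n p0) (atin_within (problem_top N) p0 (P14_minus N))"
    and "filterlim (eigval N (N - 1)) at_top (atin_within (problem_top N) p0 (P14_minus N))"
    and "n < N - 1 \<Longrightarrow> (eigval N (Suc n) \<longlongrightarrow> eigval N n p0) (atin_within (problem_top N) p0 (P14_plus N))"
    and "filterlim (eigval N 0) at_bot (atin_within (problem_top N) p0 (P14_plus N))"
proof -
  have p0': "p0 \<in> Omega N \<times> O14" "gap p0 = 0" using p0 by (simp_all add: P14_iff)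
  note lim = problem_tendsto[OF N p0'(1)]
  obtain v0 where v0: "diagonalized {2..N} (reduced_energy N p0) (reduced_weight N p0) v0 (\<lambda>n. eigval N n p0)"
    using singular_problem_diagonalized[OF N p0] by blast
  have J: "insert 1 {2..N} = {1..N}" using N by auto
  have ev: "\<forall>\<^sub>F p in atin_within (problem_top N) p0 S. \<exists>v. diagonalized (insert 1 {2..N})
      (add_penalty 1 (1 / gap p) (reduced_energy N p)) (reduced_weight N p) v (\<lambda>n. eigval N n p)"
    if "\<And>p. p \<in> S \<Longrightarrow> p \<in> Omega N \<times> O14 \<and> gap p \<noteq> 0" for S
    unfolding J using eventually_atin_within_self
    by (rule eventually_mono) (use regular_problem_diagonalized[OF N] that in blast)
  have gap: "(gap \<longlongrightarrow> 0) (atin_within (problem_top N) p0 S)" for S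
    using lim(3)[where S=S] p0'(2) by simp
  have top: "filterlim (\<lambda>p. 1 / gap p) at_top (atin_within (problem_top N) p0 (P14_minus N))"
    unfolding divide_inverse mult_1
    by (rule filterlim_inverse_at_top[OF gap])
       (rule eventually_mono[OF eventually_atin_within_self], simp add: P14_iff)
  have bot: "filterlim (\<lambda>p. 1 / gap p) at_bot (atin_within (problem_top N) p0 (P14_plus N))"
    unfolding divide_inverse mult_1
    by (rule filterlim_inverse_at_bot[OF gap])
       (rule eventually_mono[OF eventually_atin_within_self], simp add: P14_iff)
  note T = diagonalized_penalty_at_top[where l="\<lambda>p n. eigval N n p", OF hermitian_reduced _ _ v0 ev lim(1,2) top]
  note B = diagonalized_penalty_at_bot[where l="\<lambda>p n. eigval N n p", OF hermitian_reduced _ _ v0 ev lim(1,2) bot]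
  show "n < N - 1 \<Longrightarrow> (eigval N n \<longlongrightarrow> eigval N n p0) (atin_within (problem_top N) p0 (P14_minus N))"
    by (rule T(1)) (auto simp: P14_iff)
  show "n < N - 1 \<Longrightarrow> (eigval N (Suc n) \<longlongrightarrow> eigval N n p0) (atin_within (problem_top N) p0 (P14_plus N))"
    by (rule B(1)) (auto simp: P14_iff)
  show "filterlim (eigval N 0) at_bot (atin_within (problem_top N) p0 (P14_plus N))"
    by (rule B(2)) (auto simp: P14_iff)
  have "filterlim (\<lambda>p. eigval N (card {2..N}) p) at_top (atin_within (problem_top N) p0 (P14_minus N))"
    by (rule T(2)) (auto simp: P14_iff)
  moreover have "card {2..N} = N - 1" by simp
  ultimately show "filterlim (eigval N (N - 1)) at_top (atin_within (problem_top N) p0 (P14_minus N))" by (simp only:)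
qed

section \<open>Joining one-sided limits; domains and discontinuity\<close>

lemma tendsto_atin_within_Un:
  assumes "(g \<longlongrightarrow> l) (atin_within X a S)" "(g \<longlongrightarrow> l) (atin_within X a T)"
  shows "(g \<longlongrightarrow> l) (atin_within X a (S \<union> T))"
proof (rule topological_tendstoI)
  fix V assume V: "open V" "l \<in> V"
  have "\<forall>\<^sub>F x in atin_within X a S. g x \<in> V" "\<forall>\<^sub>F x in atin_within X a T. g x \<in> V"
    using assms[THEN topological_tendstoD, OF V] by auto
  then show "\<forall>\<^sub>F x in atin_within X a (S \<union> T). g x \<in> V"
    unfolding eventually_atin_within
  proof (elim disjE exE conjE)
    fix A B
    assume "openin X A" "a \<in> A" "\<forall>x\<in>A. x \<in> S \<and> x \<noteq> a \<longrightarrow> g x \<in> V"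
      "openin X B" "a \<in> B" "\<forall>x\<in>B. x \<in> T \<and> x \<noteq> a \<longrightarrow> g x \<in> V"
    then show "a \<notin> topspace X \<or>
        (\<exists>A. openin X A \<and> a \<in> A \<and> (\<forall>x\<in>A. x \<in> S \<union> T \<and> x \<noteq> a \<longrightarrow> g x \<in> V))"
      by (intro disjI2 exI[of _ "A \<inter> B"]) auto
  qed simp_all
qed

lemma atin_within_mono: "S \<subseteq> T \<Longrightarrow> atin_within X a S \<le> atin_within X a T"
  unfolding atin_within_def by (intro inf_mono order_refl) auto

lemma problem_has_exactly_eigenvalues:
  assumes "N \<ge> 2" "p \<in> Omega N \<times> O14"
  shows "has_exactly_eigenvalues N p (if gap p = 0 then N - 1 else N)"
  using problem_spectrum(1)[OF assms] by (simp split: if_splits)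

lemma mem_eigval_defined:
  assumes "N \<ge> 2" "p \<in> Omega N \<times> O14"
  shows "p \<in> eigval_defined N n \<longleftrightarrow> n < (if gap p = 0 then N - 1 else N)"
proof -
  have "p \<in> topspace (problem_top N)" using assms(2) O14_eq[of 1 1] by (auto simp: topspace_problem_top)
  with problem_has_exactly_eigenvalues[OF assms] show ?thesis
    unfolding eigval_defined_def has_exactly_eigenvalues_def by simp
qed

text \<open>The limit from \<open>P14_plus\<close> decides. For \<open>n = 0\<close> it is minus
  infinity, for positive \<open>n\<close> it is the preceding eigenvalue at \<open>p0\<close>, which
  continuity would force to equal the \<open>n\<close>-th. For \<open>n = N - 1\<close> the
  eigenvalue is undefined at \<open>p0\<close>. Uniqueness of limits applies because
  \<open>p0\<close> is a limit point of \<open>P14_plus\<close>.\<close>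

lemma eigval_discontinuous:
  assumes N: "N \<ge> 2" and p0: "p0 \<in> P14 N"
    and cont: "eigval_continuous_at N n p0"
  shows "1 \<le> n \<and> n \<le> N - 2 \<and> eigval N (n - 1) p0 = eigval N n p0"
proof -
  let ?F = "atin_within (problem_top N) p0 (P14_plus N)"
  have p0': "p0 \<in> Omega N \<times> O14" "gap p0 = 0" using p0 by (simp_all add: P14_iff)
  have n: "n < N - 1"
    using cont mem_eigval_defined[OF N p0'(1)] p0'(2) by (simp add: eigval_continuous_at_def)
  have "P14_plus N \<subseteq> eigval_defined N n"
  proof
    fix p assume "p \<in> P14_plus N"
    then have "p \<in> Omega N \<times> O14" "gap p \<noteq> 0" by (simp_all add: P14_iff)
    then show "p \<in> eigval_defined N n" using mem_eigval_defined[OF N, of p n] n by simp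
  qed
  moreover have "(eigval N n \<longlongrightarrow> eigval N n p0) (atin_within (problem_top N) p0 (eigval_defined N n))"
    using cont by (simp add: eigval_continuous_at_def)
  ultimately have lim: "(eigval N n \<longlongrightarrow> eigval N n p0) ?F"
    by (rule tendsto_mono[OF atin_within_mono])
  have "n \<noteq> 0"
  proof
    assume "n = 0"
    then have "filterlim (eigval N n) at_infinity ?F"
      using eigval_tendsto_singular(4)[OF N p0] filterlim_at_bot_imp_at_infinity by blast
    with lim show False using not_tendsto_and_filterlim_at_infinity[OF P14_plus_limit_point[OF p0]] by blast
  qed
  then obtain m where m: "n = Suc m" by (cases n) auto
  have "(eigval N n \<longlongrightarrow> eigval N m p0) ?F"
    unfolding m by (rule eigval_tendsto_singular(3)[OF N p0]) (use n m in simp)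
  then have "eigval N m p0 = eigval N n p0"
    using lim P14_plus_limit_point[OF p0] tendsto_unique by blast
  with n m show ?thesis by auto
qed

text \<open>The discontinuity clause exempts indices with
  \<open>eigval N (n - 1) p0 = eigval N n p0\<close>. For these the limits from the two sides
  coincide with the value at \<open>p0\<close>, so the n-th eigenvalue is continuous there.\<close>

theorem theorem5p1:
  fixes N :: nat
  assumes "N \<ge> 2"
  shows
    "(\<forall>p\<in>P14 N. has_exactly_eigenvalues N p (N - 1)) \<and>
     (\<forall>p\<in>(Omega N \<times> O14) - P14 N. has_exactly_eigenvalues N p N) \<and>
     (\<forall>n\<le>N - 1. \<forall>p\<in>(Omega N \<times> O14) - P14 N. eigval_continuous_at N n p) \<and>
     (\<forall>p0\<in>P14 N. \<forall>n\<le>N - 1.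
        \<not> (1 \<le> n \<and> n \<le> N - 2 \<and> eigval N (n - 1) p0 = eigval N n p0) \<longrightarrow>
        \<not> eigval_continuous_at N n p0) \<and>
     (\<forall>p0\<in>P14 N.
        (\<forall>n\<le>N - 2. (eigval N n \<longlongrightarrow> eigval N n p0)
                       (atin_within (problem_top N) p0 (P14_minus N \<union> P14 N))) \<and>
        filterlim (eigval N (N - 1)) at_top (atin_within (problem_top N) p0 (P14_minus N)) \<and>
        filterlim (eigval N 0) at_bot (atin_within (problem_top N) p0 (P14_plus N)) \<and>
        (\<forall>n. 1 \<le> n \<and> n \<le> N - 1 \<longrightarrow>
           (eigval N n \<longlongrightarrow> eigval N (n - 1) p0)
             (atin_within (problem_top N) p0 (P14_plus N)))) \<and>
     (\<forall>n\<le>N - 2. continuous_map (subtopology (problem_top N) (P14_minus N \<union> P14 N))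
                    euclideanreal (eigval N n))"
proof -
  note N = assms
  have regular: "p \<in> Omega N \<times> O14 \<and> gap p \<noteq> 0" if "p \<in> (Omega N \<times> O14) - P14 N" for p
    using that by (auto simp: P14_iff)
  have below: "(eigval N n \<longlongrightarrow> eigval N n p0) (atin_within (problem_top N) p0 (P14_minus N \<union> P14 N))"
    if "p0 \<in> P14 N" "n \<le> N - 2" for p0 n
    by (intro tendsto_atin_within_Un eigval_tendsto_singular(1) eigval_tendsto_P14) (use N that in auto)
  show ?thesis
  proof (intro conjI ballI allI impI)
    fix p assume "p \<in> P14 N"
    then show "has_exactly_eigenvalues N p (N - 1)"
      using problem_has_exactly_eigenvalues[OF N, of p] by (simp add: P14_iff)
  next
    fix p assume "p \<in> (Omega N \<times> O14) - P14 N"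
    then show "has_exactly_eigenvalues N p N"
      using problem_has_exactly_eigenvalues[OF N, of p] regular[of p] by simp
  next
    fix n p assume n: "n \<le> N - 1" and p: "p \<in> (Omega N \<times> O14) - P14 N"
    then have "p \<in> eigval_defined N n"
      using mem_eigval_defined[OF N, of p n] regular[OF p] N by auto
    then show "eigval_continuous_at N n p"
      unfolding eigval_continuous_at_def
      using eigval_tendsto_regular[OF N, of p n] regular[OF p] n N by auto
  next
    fix p0 n
    assume "p0 \<in> P14 N" "\<not> (1 \<le> n \<and> n \<le> N - 2 \<and> eigval N (n - 1) p0 = eigval N n p0)"
    then show "\<not> eigval_continuous_at N n p0" using eigval_discontinuous[OF N] by blast
  next
    fix p0 assume p0: "p0 \<in> P14 N"
    show "(eigval N n \<longlongrightarrow> eigval N n p0) (atin_within (problem_top N) p0 (P14_minus N \<union> P14 N))"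
      if "n \<le> N - 2" for n by (rule below[OF p0 that])
    show "filterlim (eigval N (N - 1)) at_top (atin_within (problem_top N) p0 (P14_minus N))"
      by (rule eigval_tendsto_singular(2)[OF N p0])
    show "filterlim (eigval N 0) at_bot (atin_within (problem_top N) p0 (P14_plus N))"
      by (rule eigval_tendsto_singular(4)[OF N p0])
    fix n assume "1 \<le> n \<and> n \<le> N - 1"
    then show "(eigval N n \<longlongrightarrow> eigval N (n - 1) p0) (atin_within (problem_top N) p0 (P14_plus N))"
      using eigval_tendsto_singular(3)[OF N p0, of "n - 1"] by (cases n) auto
  next
    fix n assume n: "n \<le> N - 2"
    show "continuous_map (subtopology (problem_top N) (P14_minus N \<union> P14 N)) euclideanreal (eigval N n)"
      unfolding continuous_map_atin
    proof
      fix p assume "p \<in> topspace (subtopology (problem_top N) (P14_minus N \<union> P14 N))"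
      then have p: "p \<in> P14_minus N \<union> P14 N" by simp
      have "(eigval N n \<longlongrightarrow> eigval N n p) (atin_within (problem_top N) p (P14_minus N \<union> P14 N))"
      \<comment> \<open>Off the hypersurface the limit exists along every set; on it, only the
        approach from the minus side or within the hypersurface is used.\<close>
      proof (cases "p \<in> P14 N")
        case False
        then have "p \<in> Omega N \<times> O14" "gap p \<noteq> 0" using p by (auto simp: P14_iff)
        then show ?thesis using n N by (intro eigval_tendsto_regular) auto
      qed (rule below[OF _ n])
      then show "limitin euclideanreal (eigval N n) (eigval N n p)
          (atin (subtopology (problem_top N) (P14_minus N \<union> P14 N)) p)"
        unfolding atin_subtopology_within[OF p] by simp
    qed
  qed
qed

end
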